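(* Let $p=p(n)$ satisfy $p\gg\left(\frac{\log n}{n}\right)^{1/2}$. Then asymptotically almost surely the binomial random graph $G(n,p)$ satisfies $G(n,p)\longrightarrow\Pi_2$, i.e. $\lim_{n\to\infty}\mathbb P\big(G(n,p)\longrightarrow\Pi_2\big)=1$.
   Context: For a graph $G=(V,E)$ we write $G\longrightarrow\Pi_2$ if for every colouring of $E$ with two colours (red and blue) there exist two monochromatic trees $T_1,T_2\subseteq G$ with $V(T_1)\cup V(T_2)=V$ and $V(T_1)\cap V(T_2)=\emptyset$; one of the trees is allowed to be empty and both trees are allowed to be of the same colour. $G(n,p)$ is the binomial random graph on $n$ vertices where each pair is an edge independently with probability $p$. The notation $p\gg f$ means $p/f\to\infty$ as $n\to\infty$. *)

theory Defs
  imports "HOL-Probability.Probability"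
begin

record 'a ugraph =
  verts :: "'a set"
  edges :: "'a set set"

definition pairs_of :: "'a set \<Rightarrow> 'a set set" where
  "pairs_of V = {e. e \<subseteq> V \<and> card e = 2}"

definition simple_graph :: "'a ugraph \<Rightarrow> bool" where
  "simple_graph G \<longleftrightarrow> finite (verts G) \<and> edges G \<subseteq> pairs_of (verts G)"

definition subgraph_of :: "'a ugraph \<Rightarrow> 'a ugraph \<Rightarrow> bool" where
  "subgraph_of H G \<longleftrightarrow> simple_graph H \<and> verts H \<subseteq> verts G \<and> edges H \<subseteq> edges G"

definition adj_rel :: "'a ugraph \<Rightarrow> ('a \<times> 'a) set" where
  "adj_rel G = {(u, v). {u, v} \<in> edges G}"

definition connected_graph :: "'a ugraph \<Rightarrow> bool" where
  "connected_graph G \<longleftrightarrow>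
     verts G \<noteq> {} \<and> (\<forall>u\<in>verts G. \<forall>v\<in>verts G. (u, v) \<in> (adj_rel G)\<^sup>*)"

text \<open>A cycle is listed by its vertices, without repeating the first one at the end.\<close>

definition is_cycle :: "'a ugraph \<Rightarrow> 'a list \<Rightarrow> bool" where
  "is_cycle G vs \<longleftrightarrow> length vs \<ge> 3 \<and> distinct vs \<and>
     successively (\<lambda>u v. {u, v} \<in> edges G) vs \<and> {last vs, hd vs} \<in> edges G"

definition is_tree :: "'a ugraph \<Rightarrow> bool" where
  "is_tree T \<longleftrightarrow> simple_graph T \<and> connected_graph T \<and> (\<nexists>vs. is_cycle T vs)"

definition empty_graph :: "'a ugraph" where
  "empty_graph = \<lparr>verts = {}, edges = {}\<rparr>"

datatype colour = Red | Blue

text \<open>Edge colourings are total functions on vertex sets; only their values on the edges matter.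
  A graph without edges is monochromatic in either colour.\<close>

definition monochromatic :: "('a set \<Rightarrow> colour) \<Rightarrow> 'a ugraph \<Rightarrow> bool" where
  "monochromatic c H \<longleftrightarrow> (\<exists>k. \<forall>e\<in>edges H. c e = k)"

text \<open>The relation \<open>G \<longrightarrow> \<Pi>\<^sub>2\<close>. As the two trees play symmetric roles, the one that is
  allowed to be empty is taken to be \<open>T\<^sub>2\<close>.\<close>

definition arrows_Pi2 :: "'a ugraph \<Rightarrow> bool" where
  "arrows_Pi2 G \<longleftrightarrow> (\<forall>c :: 'a set \<Rightarrow> colour. \<exists>T\<^sub>1 T\<^sub>2.
     subgraph_of T\<^sub>1 G \<and> subgraph_of T\<^sub>2 G \<and>
     is_tree T\<^sub>1 \<and> (is_tree T\<^sub>2 \<or> T\<^sub>2 = empty_graph) \<and>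
     monochromatic c T\<^sub>1 \<and> monochromatic c T\<^sub>2 \<and>
     verts T\<^sub>1 \<union> verts T\<^sub>2 = verts G \<and> verts T\<^sub>1 \<inter> verts T\<^sub>2 = {})"

definition gnp :: "nat \<Rightarrow> real \<Rightarrow> nat ugraph pmf" where
  "gnp n p = map_pmf (\<lambda>X. \<lparr>verts = {1..n}, edges = {e \<in> pairs_of {1..n}. X e}\<rparr>)
     (Pi_pmf (pairs_of {1..n}) False (\<lambda>_. bernoulli_pmf p))"

end

theory Submission
  imports Defs
begin

text \<open>
  Write \<open>k\<close> for \<open>2 log n\<close> and \<open>s\<close> for a large multiple of \<open>log n / p\<close>. Almost surely all
  codegrees are much larger than \<open>k\<close>, disjoint sets of size at least \<open>s\<close> span the expected number of
  edges up to a factor 2, and every nonempty set \<open>F\<close> of size at most \<open>2 s\<close> has a vertex with only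
  \<open>O(log n)\<close> neighbours in \<open>F\<close>.

  Fix a colouring, take a large star in one colour and close it under adding vertices that send at
  least \<open>k\<close> edges of that colour into the current set, reaching \<open>S\<close>; put \<open>F = V - S\<close>. If \<open>F\<close> is
  small, let \<open>y\<close> have few neighbours in \<open>F\<close>. Vertices of \<open>F\<close> send fewer than \<open>k\<close> edges of the first
  colour to \<open>S\<close>, so \<open>y\<close> has at least \<open>k\<close> common neighbours in \<open>S\<close>, in the other colour, with every
  other vertex of \<open>F\<close>. A random subset \<open>H\<close> of \<open>S\<close> meets each of these sets, while all of \<open>S\<close> stays
  attached to \<open>S - H\<close>; hence \<open>F\<close> can be joined to \<open>y\<close> through vertices of \<open>H\<close>. If \<open>F\<close> is large,
  almost all edges between \<open>F\<close> and \<open>S\<close> have the other colour, and the closure of a star of these edges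
  misses fewer than \<open>2 s\<close> vertices.
\<close>

subsection \<open>Growing monochromatic trees\<close>

lemma is_cycle_succ:
  assumes "is_cycle G vs" "i < length vs"
  shows "{vs ! i, vs ! ((i + 1) mod length vs)} \<in> edges G"
proof (cases "i + 1 < length vs")
  case True
  then show ?thesis
    using assms by (auto simp: is_cycle_def successively_conv_nth)
next
  case False
  then have "i + 1 = length vs" "vs \<noteq> []" using assms(2) by auto
  then show ?thesis
    using assms by (simp add: is_cycle_def hd_conv_nth last_conv_nth flip: \<open>i + 1 = length vs\<close>)
qed

text \<open>The new vertex lies on a single edge, while every vertex of a cycle lies on two, so no
  cycle passes through it. A cycle avoiding it would already be a cycle of \<open>T\<close>.\<close>

lemma is_tree_insert_leaf:
  assumes T: "is_tree T" and u: "u \<in> verts T" and v: "v \<notin> verts T"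
  shows "is_tree \<lparr>verts = insert v (verts T), edges = insert {u, v} (edges T)\<rparr>" (is "is_tree ?T")
proof -
  have sg: "simple_graph T" and cg: "connected_graph T" and nc: "\<nexists>vs. is_cycle T vs"
    using T unfolding is_tree_def by blast+
  have ne: "u \<noteq> v" using u v by auto
  have "simple_graph ?T"
    using sg u ne by (auto simp: simple_graph_def pairs_of_def)
  moreover have "connected_graph ?T"
  proof -
    have mono: "(adj_rel T)\<^sup>* \<subseteq> (adj_rel ?T)\<^sup>*"
      by (rule rtrancl_mono) (auto simp: adj_rel_def)
    have uv: "(u, v) \<in> (adj_rel ?T)\<^sup>*" "(v, u) \<in> (adj_rel ?T)\<^sup>*"
      by (auto simp: adj_rel_def insert_commute intro!: r_into_rtrancl)
    have "(a, u) \<in> (adj_rel ?T)\<^sup>*" "(u, a) \<in> (adj_rel ?T)\<^sup>*"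
      if "a \<in> insert v (verts T)" for a
    proof -
      have "(a, u) \<in> (adj_rel T)\<^sup>* \<and> (u, a) \<in> (adj_rel T)\<^sup>*" if "a \<in> verts T" for a
        using cg that u by (simp add: connected_graph_def)
      then show "(a, u) \<in> (adj_rel ?T)\<^sup>*" "(u, a) \<in> (adj_rel ?T)\<^sup>*"
        using that mono uv by (cases "a = v"; blast)+
    qed
    then have "(a, b) \<in> (adj_rel ?T)\<^sup>*"
      if "a \<in> insert v (verts T)" "b \<in> insert v (verts T)" for a b
      using that rtrancl_trans[of a u "adj_rel ?T" b] by blast
    then show ?thesis
      unfolding connected_graph_def by simp
  qed
  moreover have "\<not> is_cycle ?T vs" for vs
  proof
    assume c: "is_cycle ?T vs"
    let ?m = "length vs"
    have m: "?m \<ge> 3" and dist: "distinct vs" using c by (auto simp: is_cycle_def)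
    have old: "v \<notin> e" if "e \<in> edges T" for e
      using that sg v by (auto simp: simple_graph_def pairs_of_def)
    show False
    proof (cases "v \<in> set vs")
      case True
      then obtain i where i: "i < ?m" "vs ! i = v" by (auto simp: in_set_conv_nth)
      \<comment> \<open>The cyclic successor and predecessor positions of \<open>v\<close>; they
        differ because a cycle has at least three vertices. Both would have to carry
        \<open>u\<close>.\<close>
      define j where "j = (if i + 1 = ?m then 0 else i + 1)"
      define l where "l = (if i = 0 then ?m - 1 else i - 1)"
      have jl: "j < ?m" "l < ?m" "j \<noteq> l" using m i(1) by (auto simp: j_def l_def)
      have "(i + 1) mod ?m = j" "(l + 1) mod ?m = i"
        using i(1) m by (auto simp: j_def l_def)
      then have "{vs ! l, v} \<in> edges ?T" "{v, vs ! j} \<in> edges ?T"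
        using is_cycle_succ[OF c jl(2)] is_cycle_succ[OF c i(1)] i(2) by auto
      then have "{vs ! l, v} = {u, v}" "{v, vs ! j} = {u, v}"
        using old by auto
      then have "vs ! l = vs ! j" using ne by (auto simp: doubleton_eq_iff)
      then show False using dist jl by (simp add: nth_eq_iff_index_eq)
    next
      case False
      have e: "{a, b} \<in> edges T" if "{a, b} \<in> edges ?T" "a \<in> set vs" "b \<in> set vs" for a b
        using that False by (auto simp: doubleton_eq_iff)
      have "successively (\<lambda>a b. {a, b} \<in> edges T) vs"
        unfolding successively_conv_nth
      proof (intro allI impI)
        fix i assume i: "Suc i < ?m"
        then have "{vs ! i, vs ! Suc i} \<in> edges ?T"
          using c unfolding is_cycle_def successively_conv_nth by blast
        then show "{vs ! i, vs ! Suc i} \<in> edges T" by (rule e) (use i in simp_all)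
      qed
      moreover have "{last vs, hd vs} \<in> edges T"
      proof -
        have "vs \<noteq> []" using m by auto
        then have "last vs \<in> set vs" "hd vs \<in> set vs" by simp_all
        moreover have "{last vs, hd vs} \<in> edges ?T" using c unfolding is_cycle_def by blast
        ultimately show ?thesis using e by blast
      qed
      ultimately have "is_cycle T vs" using m dist by (simp add: is_cycle_def)
      then show False using nc by blast
    qed
  qed
  ultimately show ?thesis by (auto simp: is_tree_def)
qed

text \<open>This amounts to: \<open>S\<close> is finite and nonempty, and the edges in
  \<open>A\<close> connect it internally. Only the vertex set is recorded, so the combinatorial
  argument never handles explicit trees.\<close>

inductive grown :: "'a set set \<Rightarrow> 'a set \<Rightarrow> bool" for A where
  grown_singleton: "grown A {x}"
| grown_insert: "grown A S \<Longrightarrow> u \<in> S \<Longrightarrow> v \<notin> S \<Longrightarrow> {u, v} \<in> A \<Longrightarrow> grown A (insert v S)"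

lemma grown_spanning_tree:
  assumes "grown A S"
  shows "\<exists>T. is_tree T \<and> verts T = S \<and> edges T \<subseteq> A"
  using assms
proof induction
  case (grown_singleton x)
  have "\<not> is_cycle \<lparr>verts = {x}, edges = {}\<rparr> vs" for vs
    by (cases vs) (auto simp: is_cycle_def)
  then have "is_tree \<lparr>verts = {x}, edges = {}\<rparr>"
    by (auto simp: is_tree_def simple_graph_def connected_graph_def)
  then show ?case by fastforce
next
  case (grown_insert S u v)
  then obtain T where "is_tree T" "verts T = S" "edges T \<subseteq> A" by blast
  with grown_insert is_tree_insert_leaf[of T u v] show ?case
    by (intro exI[of _ "\<lparr>verts = insert v (verts T), edges = insert {u, v} (edges T)\<rparr>"]) auto
qed

lemma grown_union:
  assumes "finite B" "grown A S" "\<And>b. b \<in> B \<Longrightarrow> b \<notin> S \<Longrightarrow> \<exists>u\<in>S. {u, b} \<in> A"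
  shows "grown A (S \<union> B)"
  using assms
proof (induction B)
  case (insert b B)
  then have g: "grown A (S \<union> B)" by blast
  show ?case
  proof (cases "b \<in> S \<union> B")
    case True then show ?thesis using g by (simp add: insert_absorb)
  next
    case False
    then show ?thesis using insert.prems(2)[of b] grown_insert[OF g, of _ b] by auto
  qed
qed simp

text \<open>It thus suffices to partition \<open>V\<close> into one or two vertex sets, each
  connected by edges of a single colour. The colours \<open>a\<close> and \<open>b\<close> may
  coincide.\<close>

lemma arrows_Pi2I:
  assumes "finite V" "E \<subseteq> pairs_of V"
    and "\<And>c :: 'a set \<Rightarrow> colour. \<exists>a b R T. grown {e \<in> E. c e = a} R \<and> (grown {e \<in> E. c e = b} T \<or> T = {}) \<and>
           R \<union> T = V \<and> R \<inter> T = {}"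
  shows "arrows_Pi2 \<lparr>verts = V, edges = E\<rparr>"
  unfolding arrows_Pi2_def
proof
  fix c :: "'a set \<Rightarrow> colour"
  obtain a b R T where R: "grown {e \<in> E. c e = a} R"
    and T: "grown {e \<in> E. c e = b} T \<or> T = {}" and RT: "R \<union> T = V" "R \<inter> T = {}"
    using assms(3)[of c] by blast
  obtain T\<^sub>1 where 1: "is_tree T\<^sub>1" "verts T\<^sub>1 = R" "edges T\<^sub>1 \<subseteq> {e \<in> E. c e = a}"
    using grown_spanning_tree[OF R] by blast
  obtain T\<^sub>2 where 2: "is_tree T\<^sub>2 \<or> T\<^sub>2 = empty_graph" "verts T\<^sub>2 = T" "edges T\<^sub>2 \<subseteq> {e \<in> E. c e = b}"
  proof (cases "T = {}")
    case True
    then show ?thesis using that[of empty_graph] by (auto simp: empty_graph_def)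
  next
    case False
    then show ?thesis using that grown_spanning_tree[of "{e \<in> E. c e = b}" T] T by blast
  qed
  have "simple_graph T\<^sub>2" using 2(1) by (auto simp: is_tree_def empty_graph_def simple_graph_def)
  moreover have "simple_graph T\<^sub>1" using 1(1) by (simp add: is_tree_def)
  ultimately have "subgraph_of T\<^sub>1 \<lparr>verts = V, edges = E\<rparr>" "subgraph_of T\<^sub>2 \<lparr>verts = V, edges = E\<rparr>"
    using 1(2,3) 2(2,3) RT unfolding subgraph_of_def by auto
  moreover have "monochromatic c T\<^sub>1" "monochromatic c T\<^sub>2"
    using 1(3) 2(3) unfolding monochromatic_def by blast+
  ultimately show "\<exists>T\<^sub>1 T\<^sub>2. subgraph_of T\<^sub>1 \<lparr>verts = V, edges = E\<rparr> \<and> subgraph_of T\<^sub>2 \<lparr>verts = V, edges = E\<rparr> \<and>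
     is_tree T\<^sub>1 \<and> (is_tree T\<^sub>2 \<or> T\<^sub>2 = empty_graph) \<and>
     monochromatic c T\<^sub>1 \<and> monochromatic c T\<^sub>2 \<and>
     verts T\<^sub>1 \<union> verts T\<^sub>2 = verts \<lparr>verts = V, edges = E\<rparr> \<and> verts T\<^sub>1 \<inter> verts T\<^sub>2 = {}"
    using 1(1,2) 2(1,2) RT by (intro exI[of _ T\<^sub>1] exI[of _ T\<^sub>2]) simp
qed

subsection \<open>Closures of stars\<close>

definition nbrs :: "'a set set \<Rightarrow> 'a \<Rightarrow> 'a set" where
  "nbrs A v = {u. {u, v} \<in> A}"

lemma nbrs_pairs_of:
  assumes "A \<subseteq> pairs_of V"
  shows "nbrs A v \<subseteq> V - {v}"
proof
  fix u assume "u \<in> nbrs A v"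
  then have "{u, v} \<subseteq> V" "card {u, v} = 2"
    using assms by (auto simp: nbrs_def pairs_of_def)
  then show "u \<in> V - {v}" by (cases "u = v") auto
qed

section \<open>Splitting a set by a random subset\<close>

lemma card_Pow_superset:
  assumes "finite Z" "M \<subseteq> Z"
  shows "card {H. M \<subseteq> H \<and> H \<subseteq> Z} = 2 ^ (card Z - card M)"
proof -
  have "{H. M \<subseteq> H \<and> H \<subseteq> Z} = (\<union>) M ` Pow (Z - M)"
  proof (intro equalityI subsetI)
    fix H assume "H \<in> {H. M \<subseteq> H \<and> H \<subseteq> Z}"
    then have "H = M \<union> (H - M)" "H - M \<in> Pow (Z - M)" by auto
    then show "H \<in> (\<union>) M ` Pow (Z - M)" by blast
  qed (use assms in auto)
  moreover have "inj_on ((\<union>) M) (Pow (Z - M))"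
    by (rule inj_onI) blast
  ultimately show ?thesis
    using assms by (simp add: card_image card_Pow card_Diff_subset finite_subset)
qed

text \<open>A union bound written as a count. A uniformly random subset of \<open>Z\<close> contains
  a given \<open>M i\<close>, or misses a given \<open>N j\<close>, with probability at most
  \<open>2 ^ - k\<close>, and there are fewer than \<open>2 ^ k\<close> such events.\<close>

lemma exists_splitting_set:
  assumes Z: "finite Z" and I: "finite I" "\<And>i. i \<in> I \<Longrightarrow> M i \<subseteq> Z \<and> k \<le> card (M i)"
    and J: "finite J" "\<And>j. j \<in> J \<Longrightarrow> N j \<subseteq> Z \<and> k \<le> card (N j)"
    and small: "card I + card J < 2 ^ k"
  shows "\<exists>H\<subseteq>Z. (\<forall>i\<in>I. \<not> M i \<subseteq> H) \<and> (\<forall>j\<in>J. N j \<inter> H \<noteq> {})"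
proof (cases "I = {} \<and> J = {}")
  case True
  then show ?thesis by blast
next
  case ne: False
  define B where "B i = {H. M i \<subseteq> H \<and> H \<subseteq> Z}" for i
  define C where "C j = {H. N j \<inter> H = {} \<and> H \<subseteq> Z}" for j
  \<comment> \<open>This keeps the truncated difference \<open>card Z - k\<close> honest. It needs
    at least one set \<open>M i\<close> or \<open>N j\<close>, which is why the case without any is
    treated apart.\<close>
  have k: "k \<le> card Z"
  proof -
    obtain X where "X \<subseteq> Z" "k \<le> card X" using ne I(2) J(2) by blast
    then show ?thesis using card_mono[OF Z] le_trans by blast
  qed
  have B: "card (B i) \<le> 2 ^ (card Z - k)" if "i \<in> I" for i
    using I(2)[OF that] card_Pow_superset[OF Z, of "M i"] by (auto simp: B_def)
  have C: "card (C j) \<le> 2 ^ (card Z - k)" if "j \<in> J" for j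
  proof -
    have "C j = Pow (Z - N j)" by (auto simp: C_def)
    moreover have "card (Z - N j) \<le> card Z - k"
      using J(2)[OF that] Z by (subst card_Diff_subset) (auto intro: finite_subset diff_le_mono2)
    ultimately show ?thesis using Z by (simp add: card_Pow)
  qed
  have "card (\<Union>(B ` I) \<union> \<Union>(C ` J)) \<le> (\<Sum>i\<in>I. card (B i)) + (\<Sum>j\<in>J. card (C j))"
    by (rule order.trans[OF card_Un_le add_mono[OF card_UN_le[OF I(1)] card_UN_le[OF J(1)]]])
  also have "\<dots> \<le> card I * 2 ^ (card Z - k) + card J * 2 ^ (card Z - k)"
    by (rule add_mono) (use sum_bounded_above[OF B] sum_bounded_above[OF C] in simp_all)
  also have "\<dots> = (card I + card J) * 2 ^ (card Z - k)" by (simp add: algebra_simps)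
  also have "\<dots> < 2 ^ k * 2 ^ (card Z - k)" using small by simp
  also have "\<dots> = card (Pow Z)" using k Z by (simp add: card_Pow flip: power_add)
  finally have lt: "card (\<Union>(B ` I) \<union> \<Union>(C ` J)) < card (Pow Z)" .
  moreover have "finite (\<Union>(B ` I) \<union> \<Union>(C ` J))"
    by (rule finite_subset[of _ "Pow Z"]) (use Z in \<open>auto simp: B_def C_def\<close>)
  ultimately have "\<not> Pow Z \<subseteq> \<Union>(B ` I) \<union> \<Union>(C ` J)"
    using card_mono[of "\<Union>(B ` I) \<union> \<Union>(C ` J)" "Pow Z"] by linarith
  then obtain H where H: "H \<subseteq> Z" "H \<notin> \<Union>(B ` I)" "H \<notin> \<Union>(C ` J)" by blast
  show ?thesis
  proof (intro exI[of _ H] conjI ballI)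
    show "\<not> M i \<subseteq> H" if "i \<in> I" for i using H that by (simp add: B_def)
    show "N j \<inter> H \<noteq> {}" if "j \<in> J" for j using H that by (simp add: C_def)
  qed (rule H(1))
qed

text \<open>Every intermediate stage of the closure process counts, in any order of additions; the
  finished closure is obtained afterwards as a stage of greatest cardinality.\<close>

inductive star_closure :: "'a set set \<Rightarrow> nat \<Rightarrow> 'a \<Rightarrow> 'a set \<Rightarrow> bool" for A k x where
  star: "star_closure A k x (insert x (nbrs A x))"
| step: "star_closure A k x S \<Longrightarrow> v \<notin> S \<Longrightarrow> k \<le> card (nbrs A v \<inter> S) \<Longrightarrow>
    star_closure A k x (insert v S)"

lemma star_closure_star: "star_closure A k x S \<Longrightarrow> insert x (nbrs A x) \<subseteq> S"
  by (induction rule: star_closure.induct) auto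

lemma star_closure_subset:
  assumes "star_closure A k x S" "A \<subseteq> pairs_of V" "x \<in> V" "0 < k"
  shows "S \<subseteq> V"
  using assms(1)
proof induction
  case star
  then show ?case using nbrs_pairs_of[OF assms(2), of x] assms(3) by auto
next
  case (step S v)
  then have "nbrs A v \<noteq> {}" using assms(4) by auto
  then obtain u where "v \<in> nbrs A u" by (auto simp: nbrs_def insert_commute)
  then have "v \<in> V" using nbrs_pairs_of[OF assms(2), of u] by blast
  then show ?case using step by blast
qed

lemma exists_maximal_star_closure:
  assumes A: "A \<subseteq> pairs_of V" and V: "finite V" "x \<in> V" and k: "0 < k"
  shows "\<exists>S. star_closure A k x S \<and> (\<forall>v. v \<notin> S \<longrightarrow> card (nbrs A v \<inter> S) < k)"
proof -
  let ?P = "\<lambda>S. star_closure A k x S"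
  have "card S < Suc (card V)" if "?P S" for S
    using star_closure_subset[OF that A V(2) k] V(1) by (simp add: card_mono less_Suc_eq_le)
  then have "\<exists>S. ?P S \<and> (\<forall>S'. ?P S' \<longrightarrow> card S' \<le> card S)"
    by (intro ex_has_greatest_nat[of _ "insert x (nbrs A x)" _ "Suc (card V)"] allI impI)
      (auto intro: star_closure.star)
  then obtain S where S: "?P S" "\<And>S'. ?P S' \<Longrightarrow> card S' \<le> card S"
    by blast
  have "card (nbrs A v \<inter> S) < k" if "v \<notin> S" for v
  proof (rule ccontr)
    assume "\<not> card (nbrs A v \<inter> S) < k"
    then have "?P (insert v S)" using S(1) that by (intro star_closure.step) auto
    moreover have "finite S"
      using star_closure_subset[OF S(1) A V(2) k] V(1) finite_subset by blast
    ultimately show False using S(2)[of "insert v S"] that by simp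
  qed
  with S(1) show ?thesis by blast
qed

text \<open>Every vertex of the closure is attached through a set of at least \<open>k\<close> earlier vertices (or
  through the centre), so deleting a set that contains none of these sets keeps everything attached.\<close>

lemma star_closure_robust:
  assumes "star_closure A k x S" "finite V" "A \<subseteq> pairs_of V"
  shows "\<exists>M. (\<forall>v\<in>S. M v \<subseteq> S \<and> (x \<in> M v \<or> k \<le> card (M v))) \<and>
    (\<forall>H. x \<notin> H \<and> (\<forall>v\<in>S. \<not> M v \<subseteq> H) \<longrightarrow>
      grown A (S - H) \<and> (\<forall>v\<in>S - {x}. \<exists>u\<in>S - H. {u, v} \<in> A))"
  using assms(1)
proof induction
  case star
  have fin: "finite (nbrs A x)"
    using nbrs_pairs_of[OF assms(3)] assms(2) finite_subset by blast
  have "grown A (insert x (nbrs A x) - H) \<and>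
      (\<forall>v\<in>insert x (nbrs A x) - {x}. \<exists>u\<in>insert x (nbrs A x) - H. {u, v} \<in> A)"
    if "x \<notin> H" for H
  proof -
    have "grown A ({x} \<union> (nbrs A x - H))"
      using fin by (intro grown_union grown_singleton) (auto simp: nbrs_def insert_commute)
    moreover have "insert x (nbrs A x) - H = {x} \<union> (nbrs A x - H)" using that by auto
    ultimately show ?thesis using that by (auto simp: nbrs_def insert_commute)
  qed
  \<comment> \<open>In the star everything is attached through the centre, and \<open>{x}\<close> is
    never contained in a set \<open>H\<close> that avoids \<open>x\<close>.\<close>
  then show ?case by (intro exI[of _ "\<lambda>_. {x}"]) auto
next
  case (step S v)
  then obtain M where M: "\<forall>v\<in>S. M v \<subseteq> S \<and> (x \<in> M v \<or> k \<le> card (M v))"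
    and MH: "\<forall>H. x \<notin> H \<and> (\<forall>v\<in>S. \<not> M v \<subseteq> H) \<longrightarrow>
      grown A (S - H) \<and> (\<forall>v\<in>S - {x}. \<exists>u\<in>S - H. {u, v} \<in> A)"
    by (elim exE conjE)
  \<comment> \<open>The new vertex is attached through all its neighbours present when it is added.
    If one of them, \<open>u\<close>, survives outside \<open>H\<close>, then \<open>u\<close>
    connects it to what remains.\<close>
  define M' where "M' = M(v := nbrs A v \<inter> S)"
  have "\<forall>w\<in>insert v S. M' w \<subseteq> insert v S \<and> (x \<in> M' w \<or> k \<le> card (M' w))"
  proof
    fix w assume "w \<in> insert v S"
    then show "M' w \<subseteq> insert v S \<and> (x \<in> M' w \<or> k \<le> card (M' w))"
      using bspec[OF M, of w] step.hyps(3) by (cases "w = v") (auto simp: M'_def)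
  qed
  moreover have "\<forall>H. x \<notin> H \<and> (\<forall>w\<in>insert v S. \<not> M' w \<subseteq> H) \<longrightarrow> grown A (insert v S - H) \<and>
      (\<forall>w\<in>insert v S - {x}. \<exists>u\<in>insert v S - H. {u, w} \<in> A)"
  proof (intro allI impI)
    fix H assume H: "x \<notin> H \<and> (\<forall>w\<in>insert v S. \<not> M' w \<subseteq> H)"
    then have "x \<notin> H \<and> (\<forall>w\<in>S. \<not> M w \<subseteq> H)"
      using step.hyps(2) by (auto simp: M'_def split: if_splits)
    then have g: "grown A (S - H)" and a: "\<forall>v\<in>S - {x}. \<exists>u\<in>S - H. {u, v} \<in> A"
      using MH[THEN spec, THEN mp, of H] by simp_all
    have "\<not> nbrs A v \<inter> S \<subseteq> H" using H by (simp add: M'_def)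
    then obtain u where u: "u \<in> S - H" "{u, v} \<in> A"
      by (auto simp: nbrs_def)
    have "grown A (insert v S - H)"
    proof (cases "v \<in> H")
      case True
      then show ?thesis using g by (simp add: insert_Diff_if)
    next
      case False
      then show ?thesis using grown_insert[OF g u(1) _ u(2)] step.hyps(2) by (simp add: insert_Diff_if)
    qed
    moreover have "\<exists>u\<in>insert v S - H. {u, w} \<in> A" if "w \<in> insert v S - {x}" for w
    proof (cases "w = v")
      case True
      then show ?thesis using u by blast
    next
      case False
      then show ?thesis using bspec[OF a, of w] that by blast
    qed
    ultimately show "grown A (insert v S - H) \<and>
      (\<forall>w\<in>insert v S - {x}. \<exists>u\<in>insert v S - H. {u, w} \<in> A)" by simp
  qed
  ultimately show ?case by (intro exI[of _ M'] conjI)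
qed

text \<open>A set \<open>H\<close> inside \<open>S\<close> is chosen that can be removed from the
  \<open>A\<close>-tree and still meets all common \<open>B\<close>-neighbourhoods of
  \<open>y\<close> with the other vertices of \<open>F\<close>. Only the vertices of
  \<open>H\<close> that are actually used as connectors move to the \<open>B\<close>-tree.\<close>

lemma two_trees_if_small_complement:
  assumes V: "finite V" and E: "E \<subseteq> pairs_of V" and ab: "A \<union> B = E"
    and k: "0 < k" "card V \<le> 2 ^ k"
    and codeg: "\<And>u v. u \<in> V \<Longrightarrow> v \<in> V \<Longrightarrow> u \<noteq> v \<Longrightarrow> d + 3 * k \<le> card (nbrs E u \<inter> nbrs E v)"
    and S: "star_closure A k x S" "x \<in> V" "\<And>v. v \<notin> S \<Longrightarrow> card (nbrs A v \<inter> S) < k"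
    and sparse: "V - S \<noteq> {} \<Longrightarrow> \<exists>y\<in>V - S. card (nbrs E y \<inter> (V - S)) \<le> d"
  shows "\<exists>R T. grown A R \<and> (grown B T \<or> T = {}) \<and> R \<union> T = V \<and> R \<inter> T = {}"
proof -
  have A: "A \<subseteq> pairs_of V" using E ab by blast
  have SV: "S \<subseteq> V" using star_closure_subset[OF S(1) A S(2) k(1)] .
  have xS: "x \<in> S" using star_closure_star[OF S(1)] by blast
  define F where "F = V - S"
  obtain M where M: "\<forall>v\<in>S. M v \<subseteq> S \<and> (x \<in> M v \<or> k \<le> card (M v))"
    and MH: "\<forall>H. x \<notin> H \<and> (\<forall>v\<in>S. \<not> M v \<subseteq> H) \<longrightarrow>
      grown A (S - H) \<and> (\<forall>v\<in>S - {x}. \<exists>u\<in>S - H. {u, v} \<in> A)"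
    using star_closure_robust[OF S(1) V A] by (elim exE conjE)
  have finS: "finite S" using SV V finite_subset by blast
  show ?thesis
  proof (cases "F = {}")
    case True
    have "M w \<noteq> {}" if "w \<in> S" for w using bspec[OF M that] k(1) by auto
    then have "grown A S" using MH[THEN spec, of "{}"] by simp
    then show ?thesis using True SV F_def by (intro exI[of _ S] exI[of _ "{}"]) auto
  next
    case False
    then obtain y where y: "y \<in> F" "card (nbrs E y \<inter> F) \<le> d" using sparse F_def by blast
    \<comment> \<open>The possible connectors between \<open>v\<close> and \<open>y\<close>. The
      centre \<open>x\<close> is left out because robustness of the closure requires
      \<open>x\<close> to stay outside \<open>H\<close>.\<close>
    define N where "N v = nbrs B y \<inter> nbrs B v \<inter> (S - {x})" for v
    have N: "k \<le> card (N v)" if v: "v \<in> F - {y}" for v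
    proof -
      \<comment> \<open>Of the \<open>d + 3 * k\<close> common neighbours, at most \<open>d\<close>
        lie in \<open>F\<close>, one may be \<open>x\<close>, and at most \<open>k - 1\<close> each
        are lost to edges of \<open>A\<close> from \<open>y\<close> and from \<open>v\<close> into
        \<open>S\<close>. More than \<open>k\<close> remain.\<close>
      have "nbrs E y \<inter> nbrs E v \<subseteq>
          N v \<union> (nbrs E y \<inter> F) \<union> {x} \<union> (nbrs A y \<inter> S) \<union> (nbrs A v \<inter> S)"
      proof
        fix t assume t: "t \<in> nbrs E y \<inter> nbrs E v"
        then have "t \<in> V" using nbrs_pairs_of[OF E, of y] by blast
        moreover have "t \<in> nbrs A y \<or> t \<in> nbrs B y" "t \<in> nbrs A v \<or> t \<in> nbrs B v"
          using t by (auto simp: nbrs_def simp flip: ab)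
        ultimately show "t \<in> N v \<union> (nbrs E y \<inter> F) \<union> {x} \<union> (nbrs A y \<inter> S) \<union> (nbrs A v \<inter> S)"
          using t unfolding N_def F_def by blast
      qed
      then have "card (nbrs E y \<inter> nbrs E v) \<le>
          card (N v \<union> (nbrs E y \<inter> F) \<union> {x} \<union> (nbrs A y \<inter> S) \<union> (nbrs A v \<inter> S))"
        by (rule card_mono[rotated]) (use finS V in \<open>auto simp: N_def F_def\<close>)
      also have "\<dots> \<le> card (N v) + card (nbrs E y \<inter> F) + card {x} + card (nbrs A y \<inter> S)
          + card (nbrs A v \<inter> S)"
        by (intro order.trans[OF card_Un_le] add_mono order.refl)
      finally have "card (nbrs E y \<inter> nbrs E v) \<le> card (N v) + d + 1 + card (nbrs A y \<inter> S)
          + card (nbrs A v \<inter> S)" using y(2) by simp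
      moreover have "y \<in> V" "v \<in> V" "y \<noteq> v" "y \<notin> S" "v \<notin> S" using y(1) v by (auto simp: F_def)
      ultimately show ?thesis
        using codeg[of y v] S(3)[of y] S(3)[of v] by linarith
    qed
    \<comment> \<open>Attachment sets containing \<open>x\<close> survive automatically, since
      \<open>H\<close> avoids \<open>x\<close>. The remaining events are indexed by disjoint subsets
      of \<open>V - {y}\<close>, so there are fewer than \<open>card V\<close>, hence fewer than
      \<open>2 ^ k\<close>.\<close>
    let ?I = "{w \<in> S. x \<notin> M w}"
    have "card ?I + card (F - {y}) = card (?I \<union> (F - {y}))"
      using finS V by (intro card_Un_disjoint[symmetric]) (auto simp: F_def)
    also have "\<dots> < card V"
      by (rule psubset_card_mono[OF V]) (use SV y in \<open>auto simp: F_def\<close>)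
    finally have lt: "card ?I + card (F - {y}) < 2 ^ k" using k(2) by linarith
    have "\<exists>H\<subseteq>S - {x}. (\<forall>i\<in>?I. \<not> M i \<subseteq> H) \<and> (\<forall>j\<in>F - {y}. N j \<inter> H \<noteq> {})"
    proof (rule exists_splitting_set[OF _ _ _ _ _ lt])
      show "M i \<subseteq> S - {x} \<and> k \<le> card (M i)" if "i \<in> ?I" for i using bspec[OF M, of i] that by auto
      show "N j \<subseteq> S - {x} \<and> k \<le> card (N j)" if "j \<in> F - {y}" for j
        using N that by (auto simp: N_def)
    qed (use finS V F_def in auto)
    then obtain H where H: "H \<subseteq> S - {x}" "\<forall>i\<in>?I. \<not> M i \<subseteq> H"
      "\<forall>j\<in>F - {y}. N j \<inter> H \<noteq> {}" by (elim exE conjE)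
    from H(3) have "\<forall>j\<in>F - {y}. \<exists>t. t \<in> N j \<inter> H" by blast
    then obtain r where "\<forall>j\<in>F - {y}. r j \<in> N j \<inter> H" by (elim bchoice[THEN exE])
    then have r: "r j \<in> N j \<inter> H" if "j \<in> F - {y}" for j using that by simp
    define Q where "Q = r ` (F - {y})"
    have "Q \<subseteq> H" "Q \<subseteq> nbrs B y" using r unfolding Q_def N_def by blast+
    moreover have "finite Q" using V by (simp add: Q_def F_def)
    ultimately have Q: "Q \<subseteq> H" "Q \<subseteq> nbrs B y" "finite Q" .
    have gA: "grown A (S - H)" "\<And>v. v \<in> S - {x} \<Longrightarrow> \<exists>u\<in>S - H. {u, v} \<in> A"
    proof -
      have "\<not> M v \<subseteq> H" if "v \<in> S" for v
        using bspec[OF H(2), of v] H(1) that by (cases "x \<in> M v") auto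
      then have "x \<notin> H \<and> (\<forall>v\<in>S. \<not> M v \<subseteq> H)" using H(1) by auto
      then show "grown A (S - H)" "\<And>v. v \<in> S - {x} \<Longrightarrow> \<exists>u\<in>S - H. {u, v} \<in> A"
        using MH[THEN spec, THEN mp, of H] by simp_all
    qed
    have "grown A ((S - H) \<union> (H - Q))"
    proof (rule grown_union[OF _ gA(1)])
      show "finite (H - Q)" using H(1) finS by (meson Diff_subset finite_subset)
      show "\<exists>u\<in>S - H. {u, b} \<in> A" if "b \<in> H - Q" for b using gA(2)[of b] H(1) that by blast
    qed
    moreover have "(S - H) \<union> (H - Q) = S - Q" using H(1) Q(1) by blast
    \<comment> \<open>The second tree has depth at most two: root \<open>y\<close>, then the
      connectors, then the rest of \<open>F\<close>.\<close>
    moreover have "grown B (({y} \<union> Q) \<union> (F - {y}))"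
    proof (rule grown_union[OF _ grown_union[OF _ grown_singleton]])
      show "\<exists>u\<in>{y}. {u, b} \<in> B" if "b \<in> Q" for b
        using that Q(2) by (auto simp: nbrs_def insert_commute)
      show "\<exists>u\<in>{y} \<union> Q. {u, b} \<in> B" if "b \<in> F - {y}" for b
      proof
        show "r b \<in> {y} \<union> Q" using that by (simp add: Q_def)
        show "{r b, b} \<in> B" using r[OF that] by (simp add: N_def nbrs_def)
      qed
    qed (use Q V F_def in simp_all)
    moreover have "S - Q \<union> (({y} \<union> Q) \<union> (F - {y})) = V" "(S - Q) \<inter> (({y} \<union> Q) \<union> (F - {y})) = {}"
      using y(1) SV Q(1) H(1) unfolding F_def by blast+
    ultimately show ?thesis
      by (intro exI[of _ "S - Q"] exI[of _ "({y} \<union> Q) \<union> (F - {y})"]) simp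
  qed
qed

subsection \<open>Pseudorandom graphs\<close>

text \<open>For disjoint \<open>U\<close> and \<open>W\<close> this is the number of edges between
  them. Written as a sum of degrees, it is bounded directly by a degree bound on one side.\<close>

definition edge_count :: "'a set set \<Rightarrow> 'a set \<Rightarrow> 'a set \<Rightarrow> nat" where
  "edge_count A U W = (\<Sum>u\<in>U. card (nbrs A u \<inter> W))"

lemma edge_count_commute:
  assumes "finite U" "finite W"
  shows "edge_count A U W = edge_count A W U"
proof -
  have *: "card (nbrs A u \<inter> W) = (\<Sum>w\<in>W. if {u, w} \<in> A then 1 else 0)" if "finite W" for u W
  proof -
    have "nbrs A u \<inter> W = {w \<in> W. {u, w} \<in> A}" by (auto simp: nbrs_def insert_commute)
    then show ?thesis using that by (simp add: sum.If_cases Int_def)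
  qed
  have "edge_count A U W = (\<Sum>u\<in>U. \<Sum>w\<in>W. if {u, w} \<in> A then 1 else 0)"
    by (simp add: edge_count_def *[OF assms(2)])
  also have "\<dots> = (\<Sum>w\<in>W. \<Sum>u\<in>U. if {w, u} \<in> A then 1 else 0)"
    by (subst sum.swap) (simp add: insert_commute)
  also have "\<dots> = edge_count A W U"
    by (simp add: edge_count_def *[OF assms(1)])
  finally show ?thesis .
qed

lemma edge_count_Un_le:
  assumes "finite W"
  shows "edge_count (A \<union> B) U W \<le> edge_count A U W + edge_count B U W"
proof -
  have "card (nbrs (A \<union> B) u \<inter> W) \<le> card (nbrs A u \<inter> W) + card (nbrs B u \<inter> W)" for u
  proof -
    have "nbrs (A \<union> B) u \<inter> W = (nbrs A u \<inter> W) \<union> (nbrs B u \<inter> W)"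
      by (auto simp: nbrs_def)
    then show ?thesis by (simp add: card_Un_le)
  qed
  then show ?thesis by (simp add: edge_count_def sum_mono flip: sum.distrib)
qed

lemma edge_count_le:
  assumes "\<And>u. u \<in> U \<Longrightarrow> card (nbrs A u \<inter> W) \<le> m"
  shows "edge_count A U W \<le> card U * m"
  unfolding edge_count_def using sum_bounded_above[OF assms] by simp

text \<open>The deterministic interface to the random graph. The threshold \<open>k\<close> is of
  order log n, \<open>s\<close> of order log n / p is the size from which densities are controlled,
  and \<open>d\<close> bounds the minimum degree inside sets of size up to \<open>2 * s\<close>. The
  bounds on \<open>p * s\<close> and \<open>p * card V\<close> make \<open>k\<close> negligible
  against densities at scale \<open>s\<close>, and \<open>s\<close> negligible against
  degrees.\<close>

locale pseudorandom_graph =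
  fixes V :: "'a set" and E :: "'a set set" and p :: real and k d s :: nat
  assumes finite_V: "finite V" and E: "E \<subseteq> pairs_of V"
    and k: "0 < k" "card V \<le> 2 ^ k" and p: "0 < p" "p \<le> 1"
    and s: "8 * real k \<le> p * real s" "32 * real s \<le> p * real (card V)"
    and codegree: "u \<in> V \<Longrightarrow> v \<in> V \<Longrightarrow> u \<noteq> v \<Longrightarrow> d + 3 * k \<le> card (nbrs E u \<inter> nbrs E v)"
    and density: "U \<subseteq> V \<Longrightarrow> W \<subseteq> V \<Longrightarrow> U \<inter> W = {} \<Longrightarrow> s \<le> card U \<Longrightarrow> s \<le> card W \<Longrightarrow>
      p * real (card U) * real (card W) / 2 \<le> real (edge_count E U W)"
    and sparsity: "F \<subseteq> V \<Longrightarrow> F \<noteq> {} \<Longrightarrow> card F \<le> 2 * s \<Longrightarrow> \<exists>y\<in>F. card (nbrs E y \<inter> F) \<le> d"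
begin

section \<open>Two monochromatic trees in a pseudorandom graph\<close>

lemma s_pos: "0 < s"
  using s(1) k(1) p by (cases "s = 0") auto

lemma small_complement:
  assumes "A \<union> B = E" "star_closure A k x S" "x \<in> V" "\<And>v. v \<notin> S \<Longrightarrow> card (nbrs A v \<inter> S) < k"
    and "card (V - S) \<le> 2 * s"
  shows "\<exists>R T. grown A R \<and> (grown B T \<or> T = {}) \<and> R \<union> T = V \<and> R \<inter> T = {}"
  by (rule two_trees_if_small_complement[OF finite_V E assms(1) k codegree assms(2-4)])
    (use sparsity[of "V - S"] assms(5) in auto)

text \<open>If the \<open>A\<close>-closure of the star misses many vertices, the cut around it has
  few edges of \<open>A\<close>, so the density condition makes it rich in \<open>B\<close>. A
  \<open>B\<close>-star across the cut then has a \<open>B\<close>-closure with small complement,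
  and the colours exchange roles.\<close>

lemma two_trees_from_star:
  assumes AB: "A \<union> B = E" and x: "x \<in> V" "2 * s \<le> card (nbrs A x)"
  shows "(\<exists>R T. grown A R \<and> (grown B T \<or> T = {}) \<and> R \<union> T = V \<and> R \<inter> T = {}) \<or>
    (\<exists>R T. grown B R \<and> (grown A T \<or> T = {}) \<and> R \<union> T = V \<and> R \<inter> T = {})"
proof -
  have A: "A \<subseteq> pairs_of V" and B: "B \<subseteq> pairs_of V" using AB E by auto
  obtain S where S: "star_closure A k x S" "\<And>v. v \<notin> S \<Longrightarrow> card (nbrs A v \<inter> S) < k"
    using exists_maximal_star_closure[OF A finite_V x(1) k(1)] by blast
  have SV: "S \<subseteq> V" by (rule star_closure_subset[OF S(1) A x(1) k(1)])
  show ?thesis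
  proof (cases "card (V - S) \<le> 2 * s")
    case True
    then show ?thesis using small_complement[OF AB S(1) x(1) S(2)] by blast
  next
    case False
    have finS: "finite S" using SV finite_V finite_subset by blast
    have "card (nbrs A x) \<le> card S"
      using star_closure_star[OF S(1)] by (intro card_mono finS) simp
    then have cS: "2 * s \<le> card S" using x(2) by simp
    \<comment> \<open>The bound is weakened to one symmetric in both sets, so that the two sides of
      the cut can be renamed below.\<close>
    have few: "edge_count A F' S' \<le> k * (card F' + card S')" if "F' \<subseteq> V - S" "S' \<subseteq> S" for F' S'
    proof -
      have "edge_count A F' S' \<le> card F' * k"
      proof (rule edge_count_le)
        fix u assume "u \<in> F'"
        then have "u \<notin> S" using that(1) by blast
        then have "card (nbrs A u \<inter> S) < k" by (rule S(2))
        moreover have "card (nbrs A u \<inter> S') \<le> card (nbrs A u \<inter> S)"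
          using that(2) finS by (intro card_mono) auto
        ultimately show "card (nbrs A u \<inter> S') \<le> k" by simp
      qed
      then show ?thesis by (simp add: algebra_simps)
    qed
    \<comment> \<open>\<open>Q\<close> is the side containing at least half of \<open>V\<close>.
      This makes average degrees from \<open>P\<close> into \<open>Q\<close> large enough to find a
      star of size \<open>s\<close>.\<close>
    obtain P Q where PQ: "P \<union> Q = V" "P \<inter> Q = {}" "2 * s \<le> card P" "2 * s \<le> card Q"
      "card V \<le> 2 * card Q"
      and fewPQ: "\<And>P' Q'. P' \<subseteq> P \<Longrightarrow> Q' \<subseteq> Q \<Longrightarrow> edge_count A P' Q' \<le> k * (card P' + card Q')"
    proof (cases "card V \<le> 2 * card S")
      case True
      show ?thesis using that[of "V - S" S] False True cS few SV by auto
    next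
      case S2: False
      have "card (V - S) = card V - card S" using SV finite_V by (simp add: card_Diff_subset finS)
      then have "card V \<le> 2 * card (V - S)" using S2 by simp
      moreover have "edge_count A P' Q' \<le> k * (card P' + card Q')"
        if "P' \<subseteq> S" "Q' \<subseteq> V - S" for P' Q'
      proof -
        have "finite P'" "finite Q'" using that finS finite_V by (auto intro: finite_subset)
        then show ?thesis using few[OF that(2,1)] by (simp add: edge_count_commute[of P'] add.commute)
      qed
      ultimately show ?thesis using that[of S "V - S"] False cS SV by auto
    qed
    have fin: "finite P" "finite Q" using PQ(1) finite_V by auto
    have cV: "real (card V) = real (card P) + real (card Q)"
      using card_Un_disjoint[OF fin PQ(2)] PQ(1) by simp
    have B_ge: "p * real (card P') * real (card Q') / 2 - real k * (real (card P') + real (card Q'))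
        \<le> real (edge_count B P' Q')"
      if "P' \<subseteq> P" "Q' \<subseteq> Q" "s \<le> card P'" "s \<le> card Q'" for P' Q'
    proof -
      have "edge_count E P' Q' \<le> edge_count A P' Q' + edge_count B P' Q'"
        using edge_count_Un_le[of Q' A B P'] AB that(2) fin(2) finite_subset by auto
      also have "\<dots> \<le> k * (card P' + card Q') + edge_count B P' Q'" using fewPQ[OF that(1,2)] by simp
      finally have "real (edge_count E P' Q') \<le> real (k * (card P' + card Q') + edge_count B P' Q')"
        by (rule of_nat_mono)
      moreover have "p * real (card P') * real (card Q') / 2 \<le> real (edge_count E P' Q')"
        using density[of P' Q'] that PQ(1,2) by blast
      ultimately show ?thesis by (simp add: algebra_simps)
    qed
    \<comment> \<open>With both sizes a, b at least s, \<open>s * (a + b) <= 2 * a * b\<close>;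
      together with \<open>8 * k <= p * s\<close> this gives
      \<open>p * a * b / 2 >= 2 * k * (a + b)\<close>. Half of it pays for the edges of
      \<open>A\<close>.\<close>
    have B_many: "k * (card P' + card Q') \<le> edge_count B P' Q'"
      if "P' \<subseteq> P" "Q' \<subseteq> Q" "s \<le> card P'" "s \<le> card Q'" for P' Q'
    proof -
      define a b where "a = real (card P')" and "b = real (card Q')"
      have ab: "real s \<le> a" "real s \<le> b" using that by (auto simp: a_def b_def)
      have "real s * b \<le> a * b" "real s * a \<le> a * b"
        using ab by (auto intro: mult_right_mono mult_left_mono simp: mult.commute[of "real s" a])
      then have "real s * (a + b) \<le> 2 * (a * b)" by (simp add: distrib_left)
      then have "p * (real s * (a + b)) \<le> p * (2 * (a * b))" using p by simp
      moreover have "8 * real k * (a + b) \<le> p * real s * (a + b)"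
        using s(1) ab by (intro mult_right_mono) auto
      ultimately have "2 * (real k * (a + b)) \<le> p * a * b / 2" by (simp add: algebra_simps)
      then have "real k * (a + b) \<le> real (edge_count B P' Q')"
        using B_ge[OF that] unfolding a_def b_def by linarith
      then have "real (k * (card P' + card Q')) \<le> real (edge_count B P' Q')"
        by (simp add: a_def b_def)
      then show ?thesis by (simp only: of_nat_le_iff)
    qed
    \<comment> \<open>Averaging: otherwise at most \<open>p * a * n / 32\<close> edges of
      \<open>B\<close> cross the cut, whereas density minus the edges of \<open>A\<close> leaves at
      least \<open>p * a * n / 4 - p * a * n / 16\<close>.\<close>
    have "\<exists>u\<in>P. s \<le> card (nbrs B u \<inter> Q)"
    proof (rule ccontr)
      assume "\<not> ?thesis"
      then have "edge_count B P Q \<le> card P * s" by (intro edge_count_le) auto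
      then have "real (edge_count B P Q) \<le> real (card P * s)" by (rule of_nat_mono)
      then have upper: "real (edge_count B P Q) \<le> real (card P) * real s" by simp
      define n where "n = real (card V)"
      define a b where "a = real (card P)" and "b = real (card Q)"
      have ge: "2 * real s \<le> a" "n \<le> 2 * b" "n = a + b" using PQ(3,5) cV by (auto simp: n_def a_def b_def)
      have pos: "0 < a" "0 < n" using ge s_pos PQ(4) by (auto simp: b_def)
      have "p * a * n \<le> p * a * (2 * b)" using ge(2) pos p by (intro mult_left_mono) auto
      then have 1: "p * a * n / 4 \<le> p * a * b / 2" by (simp add: algebra_simps)
      have "8 * real k * n \<le> p * real s * n" using s(1) pos by (intro mult_right_mono) auto
      also have "\<dots> \<le> p * (a / 2) * n" using ge(1) pos p by (intro mult_right_mono mult_left_mono) auto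
      finally have 2: "real k * n \<le> p * a * n / 16" by (simp add: algebra_simps)
      have "a * (32 * real s) \<le> a * (p * n)" using s(2) pos by (intro mult_left_mono) (auto simp: n_def)
      then have 3: "a * real s \<le> p * a * n / 32" by (simp add: algebra_simps)
      have "p * a * b / 2 - real k * n \<le> real (edge_count B P Q)"
        using B_ge[of P Q] PQ(3,4) ge(3) by (simp add: a_def b_def)
      then have "p * a * n / 4 - p * a * n / 16 \<le> p * a * n / 32"
        using 1 2 3 upper unfolding a_def[symmetric] by linarith
      moreover have "0 < p * a * n" using p pos by simp
      ultimately show False by linarith
    qed
    then obtain u where u: "u \<in> P" "s \<le> card (nbrs B u \<inter> Q)" by blast
    have uV: "u \<in> V" using u(1) PQ(1) by blast
    obtain S' where S': "star_closure B k u S'" "\<And>v. v \<notin> S' \<Longrightarrow> card (nbrs B v \<inter> S') < k"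
      using exists_maximal_star_closure[OF B finite_V uV k(1)] by blast
    have S'V: "S' \<subseteq> V" by (rule star_closure_subset[OF S'(1) B uV k(1)])
    have finS': "finite S'" using S'V finite_V finite_subset by blast
    have few': "edge_count B W U \<le> card W * k" if "W \<inter> S' = {}" "U \<subseteq> S'" for W U
    proof (rule edge_count_le)
      fix w assume "w \<in> W"
      then have "w \<notin> S'" using that(1) by blast
      then have "card (nbrs B w \<inter> S') < k" by (rule S'(2))
      moreover have "card (nbrs B w \<inter> U) \<le> card (nbrs B w \<inter> S')"
        using that(2) finS' by (intro card_mono) auto
      ultimately show "card (nbrs B w \<inter> U) \<le> k" by simp
    qed
    \<comment> \<open>Vertices outside the closure send at most \<open>k\<close> edges of
      \<open>B\<close> each to the leaves of the star, but \<open>B_many\<close> would give an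
      additional \<open>k\<close> for every leaf. The same contradiction bounds
      \<open>Q - S'\<close>, with \<open>P \<inter> S'\<close> in place of the leaves.\<close>
    have 1: "card (P - S') < s"
    proof (rule ccontr)
      assume "\<not> card (P - S') < s"
      then have "k * (card (P - S') + card (nbrs B u \<inter> Q)) \<le> edge_count B (P - S') (nbrs B u \<inter> Q)"
        using u(2) by (intro B_many) auto
      also have "\<dots> \<le> card (P - S') * k"
        using star_closure_star[OF S'(1)] by (intro few') auto
      finally have "k * card (nbrs B u \<inter> Q) = 0" by (simp add: algebra_simps)
      then show False using k(1) u(2) s_pos by simp
    qed
    have "card P = card (P \<inter> S') + card (P - S')"
      using card_Un_disjoint[of "P \<inter> S'" "P - S'"] fin by (simp add: Int_Diff_Un Int_Diff_disjoint)
    then have PS: "s \<le> card (P \<inter> S')" using 1 PQ(3) by simp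
    have 2: "card (Q - S') < s"
    proof (rule ccontr)
      assume "\<not> card (Q - S') < s"
      then have "k * (card (P \<inter> S') + card (Q - S')) \<le> edge_count B (P \<inter> S') (Q - S')"
        using PS by (intro B_many) auto
      also have "\<dots> = edge_count B (Q - S') (P \<inter> S')" using fin by (intro edge_count_commute) auto
      also have "\<dots> \<le> card (Q - S') * k" by (intro few') auto
      finally have "k * card (P \<inter> S') = 0" by (simp add: algebra_simps)
      then show False using k(1) PS s_pos by simp
    qed
    have "card (V - S') \<le> card (P - S') + card (Q - S')"
      using card_Un_le[of "P - S'" "Q - S'"] by (simp add: Un_Diff PQ(1)[symmetric])
    then have "card (V - S') \<le> 2 * s" using 1 2 by simp
    then show ?thesis
      using small_complement[of B A, OF _ S'(1) uV S'(2)] AB by (simp add: Un_commute)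
  qed
qed

text \<open>In a balanced cut of \<open>V\<close>, the density condition forces average degree at
  least \<open>p * card V / 4\<close>, hence at least \<open>8 * s\<close>, from one half into the
  other.\<close>

lemma large_degree: "\<exists>x\<in>V. 4 * s \<le> card (nbrs E x)"
proof (rule ccontr)
  assume "\<not> ?thesis"
  then have lt: "card (nbrs E x) \<le> 4 * s" if "x \<in> V" for x using that by force
  define n where "n = card V"
  have "p * real n \<le> real n" using p by (simp add: mult_left_le_one_le)
  then have sn: "32 * s \<le> n" using s(2) by (simp add: n_def)
  obtain U where U: "U \<subseteq> V" "card U = n div 2"
    using obtain_subset_with_card_n[of "n div 2" V] by (auto simp: n_def)
  have finU: "finite U" using U finite_V finite_subset by blast
  have W: "card (V - U) = n - n div 2" using U finU by (simp add: card_Diff_subset n_def)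
  have "edge_count E U (V - U) \<le> card U * (4 * s)"
  proof (rule edge_count_le)
    fix u assume "u \<in> U"
    then have "card (nbrs E u) \<le> 4 * s" using U lt by blast
    moreover have "finite (nbrs E u)" using nbrs_pairs_of[OF E, of u] finite_V finite_subset by blast
    ultimately show "card (nbrs E u \<inter> (V - U)) \<le> 4 * s"
      using card_mono[of "nbrs E u" "nbrs E u \<inter> (V - U)"] by simp
  qed
  moreover have "p * real (card U) * real (card (V - U)) / 2 \<le> real (edge_count E U (V - U))"
    using U W sn by (intro density) auto
  ultimately have "p * real (card U) * real (card (V - U)) / 2 \<le> real (card U * (4 * s))"
    by linarith
  then have "real (card U) * (p * real (card (V - U)) / 2) \<le> real (card U) * (4 * real s)"
    by (simp add: mult_ac)
  moreover have "0 < real (card U)" using U(2) sn s_pos by simp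
  ultimately have "p * real (card (V - U)) / 2 \<le> 4 * real s"
    by (simp only: mult_le_cancel_left_pos)
  moreover have "p * real n / 2 \<le> p * real (card (V - U))"
  proof -
    have "n \<le> 2 * card (V - U)" using W by simp
    then have "real n \<le> 2 * real (card (V - U))" by linarith
    then show ?thesis using p by simp
  qed
  ultimately show False using s(2) s_pos unfolding n_def by linarith
qed

lemma arrows_Pi2: "arrows_Pi2 \<lparr>verts = V, edges = E\<rparr>"
proof (rule arrows_Pi2I[OF finite_V E])
  fix c :: "'a set \<Rightarrow> colour"
  let ?A = "\<lambda>a. {e \<in> E. c e = a}"
  obtain x where x: "x \<in> V" "4 * s \<le> card (nbrs E x)" using large_degree by blast
  have un: "?A Red \<union> ?A Blue = E" "?A Blue \<union> ?A Red = E" using colour.exhaust by auto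
  have "nbrs E x = nbrs (?A Red) x \<union> nbrs (?A Blue) x"
    using un(1) by (auto simp: nbrs_def)
  then have "4 * s \<le> card (nbrs (?A Red) x) + card (nbrs (?A Blue) x)"
    using x(2) card_Un_le[of "nbrs (?A Red) x" "nbrs (?A Blue) x"] by simp
  \<comment> \<open>By pigeonhole, one colour keeps half of the \<open>4 * s\<close> edges at
    \<open>x\<close>: a monochromatic star of the size required above.\<close>
  then consider "2 * s \<le> card (nbrs (?A Red) x)" | "2 * s \<le> card (nbrs (?A Blue) x)" by linarith
  then show "\<exists>a b R T. grown (?A a) R \<and> (grown (?A b) T \<or> T = {}) \<and> R \<union> T = V \<and> R \<inter> T = {}"
  proof cases
    case 1
    show ?thesis using two_trees_from_star[OF un(1) x(1) 1] by blast
  next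
    case 2
    show ?thesis using two_trees_from_star[OF un(2) x(1) 2] by blast
  qed
qed

end

subsection \<open>Chernoff bounds for disjoint blocks of edges\<close>

lemma prob_Pi_bernoulli_all:
  assumes "finite A" "S \<subseteq> A" "0 \<le> q" "q \<le> 1"
  shows "measure_pmf.prob (Pi_pmf A False (\<lambda>_. bernoulli_pmf q)) {X. \<forall>e\<in>S. X e} = q ^ card S"
proof -
  have "{X. \<forall>e\<in>S. X e} = Pi A (\<lambda>e. if e \<in> S then {True} else UNIV)"
    using assms(2) by (auto simp: Pi_def)
  then have "measure_pmf.prob (Pi_pmf A False (\<lambda>_. bernoulli_pmf q)) {X. \<forall>e\<in>S. X e}
      = (\<Prod>e\<in>A. measure_pmf.prob (bernoulli_pmf q) (if e \<in> S then {True} else UNIV))"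
    by (simp add: measure_Pi_pmf_Pi[OF assms(1)])
  also have "\<dots> = (\<Prod>e\<in>A. if e \<in> S then q else 1)"
    using assms(3,4) by (intro prod.cong) (auto simp: measure_pmf_single)
  also have "\<dots> = q ^ card S"
    using assms(1,2) by (simp add: prod.If_cases Int_absorb1)
  finally show ?thesis .
qed

lemma sum_Pow_power:
  fixes x :: real
  assumes "finite W"
  shows "(\<Sum>T\<in>Pow W. x ^ card T) = (1 + x) ^ card W"
  using prod_add[OF assms, of "\<lambda>_. x" "\<lambda>_. 1"] by (simp add: add.commute)

text \<open>The generating function of a binomial count, without invoking independence of the block
  events. Writing the power as a product of factors \<open>1 + (c - 1) * indicator\<close> and
  expanding over \<open>T \<subseteq> W\<close>, each term requires exactly
  \<open>b * card T\<close> distinct edges because the blocks are disjoint.\<close>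

lemma expectation_power_count:
  fixes B :: "'i \<Rightarrow> 'a set" and c q :: real
  assumes A: "finite A" and W: "finite W" and q: "0 \<le> q" "q \<le> 1"
    and B: "\<And>w. w \<in> W \<Longrightarrow> B w \<subseteq> A" "\<And>w. w \<in> W \<Longrightarrow> card (B w) = b" "disjoint_family_on B W"
  shows "measure_pmf.expectation (Pi_pmf A False (\<lambda>_. bernoulli_pmf q))
      (\<lambda>X. c ^ card {w \<in> W. \<forall>e\<in>B w. X e}) = (1 + (c - 1) * q ^ b) ^ card W"
proof -
  let ?M = "Pi_pmf A False (\<lambda>_. bernoulli_pmf q)"
  have int: "integrable (measure_pmf ?M) (\<lambda>X. (c - 1) ^ card T * indicator {X. \<forall>e\<in>\<Union>(B ` T). X e} X)" for T
    by (rule measure_pmf.integrable_const_bound[where B = "\<bar>c - 1\<bar> ^ card T"])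
      (auto simp: indicator_def power_abs)
  have "c ^ card {w \<in> W. \<forall>e\<in>B w. X e} =
      (\<Sum>T\<in>Pow W. (c - 1) ^ card T * indicator {X. \<forall>e\<in>\<Union>(B ` T). X e} X)" for X :: "'a \<Rightarrow> bool"
  proof -
    have "c ^ card {w \<in> W. \<forall>e\<in>B w. X e} = (\<Prod>w\<in>W. (c - 1) * indicator {X. \<forall>e\<in>B w. X e} X + 1)"
    proof -
      have "(\<Prod>w\<in>W. (c - 1) * indicator {X. \<forall>e\<in>B w. X e} X + 1) = (\<Prod>w\<in>W. if \<forall>e\<in>B w. X e then c else 1)"
        by (intro prod.cong) auto
      then show ?thesis using W by (simp add: prod.If_cases Int_def)
    qed
    also have "\<dots> = (\<Sum>T\<in>Pow W. (\<Prod>w\<in>T. (c - 1) * indicator {X. \<forall>e\<in>B w. X e} X))"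
      by (simp add: prod_add[OF W])
    also have "\<dots> = (\<Sum>T\<in>Pow W. (c - 1) ^ card T * indicator {X. \<forall>e\<in>\<Union>(B ` T). X e} X)"
    proof (rule sum.cong)
      fix T assume "T \<in> Pow W"
      then have "finite T" using W finite_subset by blast
      then have "(\<Prod>w\<in>T. indicator {X. \<forall>e\<in>B w. X e} X) = (indicator {X. \<forall>e\<in>\<Union>(B ` T). X e} X :: real)"
        by (induction T) (auto simp: indicator_def)
      then show "(\<Prod>w\<in>T. (c - 1) * indicator {X. \<forall>e\<in>B w. X e} X) =
          (c - 1) ^ card T * indicator {X. \<forall>e\<in>\<Union>(B ` T). X e} X"
        by (simp add: prod.distrib)
    qed simp
    finally show ?thesis .
  qed
  then have "measure_pmf.expectation ?M (\<lambda>X. c ^ card {w \<in> W. \<forall>e\<in>B w. X e}) =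
      (\<Sum>T\<in>Pow W. (c - 1) ^ card T * measure_pmf.prob ?M {X. \<forall>e\<in>\<Union>(B ` T). X e})"
    using int by (simp add: Bochner_Integration.integral_sum)
  also have "\<dots> = (\<Sum>T\<in>Pow W. ((c - 1) * q ^ b) ^ card T)"
  proof (rule sum.cong)
    fix T assume "T \<in> Pow W"
    then have T: "T \<subseteq> W" "finite T" using W finite_subset by auto
    have "card (\<Union>(B ` T)) = (\<Sum>w\<in>T. card (B w))"
    proof (rule card_UN_disjoint[OF T(2)])
      show "\<forall>i\<in>T. finite (B i)" using B(1) T(1) A finite_subset by blast
      show "\<forall>i\<in>T. \<forall>j\<in>T. i \<noteq> j \<longrightarrow> B i \<inter> B j = {}"
        using B(3) T(1) unfolding disjoint_family_on_def by blast
    qed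
    also have "\<dots> = b * card T"
      using B(2) T(1) by (simp add: subset_eq)
    finally have "card (\<Union>(B ` T)) = b * card T" .
    moreover have "\<Union>(B ` T) \<subseteq> A" using B(1) T(1) by blast
    ultimately have "measure_pmf.prob ?M {X. \<forall>e\<in>\<Union>(B ` T). X e} = q ^ (b * card T)"
      using prob_Pi_bernoulli_all[OF A _ q, of "\<Union>(B ` T)"] by simp
    then show "(c - 1) ^ card T * measure_pmf.prob ?M {X. \<forall>e\<in>\<Union>(B ` T). X e} = ((c - 1) * q ^ b) ^ card T"
      by (simp add: power_mult power_mult_distrib)
  qed simp
  finally show ?thesis by (simp add: sum_Pow_power[OF W])
qed

text \<open>Markov's inequality for \<open>exp (\<theta> * N)\<close>, where N is the number of
  fully present blocks. Keeping \<open>\<theta>\<close> on both sides of the event covers both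
  tails: it reads N >= t for positive and N <= t for negative \<open>\<theta>\<close>.\<close>

lemma chernoff:
  fixes B :: "'i \<Rightarrow> 'a set" and q \<theta> t :: real
  assumes "finite A" and W: "finite W" and q: "0 \<le> q" "q \<le> 1"
    and "\<And>w. w \<in> W \<Longrightarrow> B w \<subseteq> A" "\<And>w. w \<in> W \<Longrightarrow> card (B w) = b" "disjoint_family_on B W"
  shows "measure_pmf.prob (Pi_pmf A False (\<lambda>_. bernoulli_pmf q))
      {X. \<theta> * t \<le> \<theta> * real (card {w \<in> W. \<forall>e\<in>B w. X e})}
    \<le> exp (q ^ b * real (card W) * (exp \<theta> - 1) - \<theta> * t)"
proof -
  let ?M = "Pi_pmf A False (\<lambda>_. bernoulli_pmf q)"
  let ?N = "\<lambda>X. card {w \<in> W. \<forall>e\<in>B w. X e}"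
  have int: "integrable (measure_pmf ?M) (\<lambda>X. exp \<theta> ^ ?N X / exp (\<theta> * t))"
  \<comment> \<open>The base \<open>1 + exp \<theta>\<close> dominates \<open>exp \<theta>\<close>
    and is at least 1, so this bound is valid for either sign of \<open>\<theta>\<close>.\<close>
  proof (rule measure_pmf.integrable_const_bound[where B = "(1 + exp \<theta>) ^ card W / exp (\<theta> * t)"], rule AE_I2)
    fix X :: "'a \<Rightarrow> bool"
    have "exp \<theta> ^ ?N X \<le> (1 + exp \<theta>) ^ ?N X" by (intro power_mono) auto
    also have "\<dots> \<le> (1 + exp \<theta>) ^ card W"
      using W by (intro power_increasing card_mono) auto
    finally show "norm (exp \<theta> ^ ?N X / exp (\<theta> * t)) \<le> (1 + exp \<theta>) ^ card W / exp (\<theta> * t)"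
      by (simp add: divide_right_mono)
  qed simp
  have "measure_pmf.prob ?M {X. \<theta> * t \<le> \<theta> * real (?N X)} =
      measure_pmf.expectation ?M (indicator {X. \<theta> * t \<le> \<theta> * real (?N X)})" by simp
  also have "\<dots> \<le> measure_pmf.expectation ?M (\<lambda>X. exp \<theta> ^ ?N X / exp (\<theta> * t))"
  proof (rule integral_mono[OF _ int])
    show "integrable (measure_pmf ?M) (indicator {X. \<theta> * t \<le> \<theta> * real (?N X)} :: _ \<Rightarrow> real)"
      by (rule measure_pmf.integrable_const_bound[where B = 1]) (auto simp: indicator_def)
    show "indicator {X. \<theta> * t \<le> \<theta> * real (?N X)} X \<le> exp \<theta> ^ ?N X / exp (\<theta> * t)" for X
      by (simp add: indicator_def mult.commute flip: exp_of_nat_mult exp_diff)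
  qed
  also have "\<dots> = (1 + (exp \<theta> - 1) * q ^ b) ^ card W / exp (\<theta> * t)"
    using expectation_power_count[OF assms] by simp
  also have "\<dots> \<le> exp ((exp \<theta> - 1) * q ^ b) ^ card W / exp (\<theta> * t)"
  proof (intro divide_right_mono power_mono)
    show "1 + (exp \<theta> - 1) * q ^ b \<le> exp ((exp \<theta> - 1) * q ^ b)" by (rule exp_ge_add_one_self)
    have "0 \<le> (1 - q ^ b) + exp \<theta> * q ^ b" using q by (intro add_nonneg_nonneg) (auto simp: power_le_one)
    then show "0 \<le> 1 + (exp \<theta> - 1) * q ^ b" by (simp add: algebra_simps)
  qed simp
  also have "\<dots> = exp (q ^ b * real (card W) * (exp \<theta> - 1) - \<theta> * t)"
    by (simp add: exp_diff mult_ac flip: exp_of_nat_mult)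
  finally show ?thesis .
qed

text \<open>Take \<open>\<theta> = - ln 2\<close>. With mean m the exponent is
  \<open>- m / 2 + t * ln 2\<close>, and \<open>t <= m / 2\<close> with \<open>ln 2 <= 3 / 4\<close>
  leaves at most \<open>- m / 8\<close>.\<close>

lemma chernoff_lower:
  fixes B :: "'i \<Rightarrow> 'a set" and q t :: real
  assumes "finite A" "finite W" "0 \<le> q" "q \<le> 1"
    and "\<And>w. w \<in> W \<Longrightarrow> B w \<subseteq> A" "\<And>w. w \<in> W \<Longrightarrow> card (B w) = b" "disjoint_family_on B W"
    and t: "t \<le> q ^ b * real (card W) / 2"
  shows "measure_pmf.prob (Pi_pmf A False (\<lambda>_. bernoulli_pmf q))
      {X. real (card {w \<in> W. \<forall>e\<in>B w. X e}) \<le> t} \<le> exp (- (q ^ b * real (card W) / 8))"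
proof -
  define m where "m = q ^ b * real (card W)"
  have "(- ln 2) * t \<le> (- ln 2) * y \<longleftrightarrow> y \<le> t" for y :: real by simp
  then have "measure_pmf.prob (Pi_pmf A False (\<lambda>_. bernoulli_pmf q))
      {X. real (card {w \<in> W. \<forall>e\<in>B w. X e}) \<le> t} \<le> exp (m * (exp (- ln 2) - 1) - (- ln 2) * t)"
    using chernoff[OF assms(1-7), of "- ln 2" t] by (simp only: m_def)
  also have "\<dots> \<le> exp (- (m / 8))"
  proof -
    have "0 \<le> m" using assms(3) by (simp add: m_def)
    have l: "0 \<le> ln (2::real)" "ln (2::real) \<le> 3 / 4" using ln2_le_25_over_36 by auto
    have "ln 2 * t \<le> ln 2 * (m / 2)" using t l by (intro mult_left_mono) (auto simp: m_def)
    also have "\<dots> \<le> 3 / 4 * (m / 2)" using l(2) \<open>0 \<le> m\<close> by (intro mult_right_mono) auto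
    finally have "m * (1 / 2 - 1) - - ln 2 * t \<le> - (m / 8)" by simp
    moreover have "exp (- ln 2) = (1 / 2 :: real)" by (simp add: exp_minus)
    ultimately show ?thesis by (simp only: exp_le_cancel_iff)
  qed
  finally show ?thesis by (simp add: m_def)
qed

text \<open>Take \<open>\<theta> = 1\<close> and bound \<open>exp 1 - 1\<close> by 2.\<close>

lemma chernoff_upper:
  fixes B :: "'i \<Rightarrow> 'a set" and q t :: real
  assumes "finite A" "finite W" "0 \<le> q" "q \<le> 1"
    and "\<And>w. w \<in> W \<Longrightarrow> B w \<subseteq> A" "\<And>w. w \<in> W \<Longrightarrow> card (B w) = b" "disjoint_family_on B W"
  shows "measure_pmf.prob (Pi_pmf A False (\<lambda>_. bernoulli_pmf q))
      {X. t \<le> real (card {w \<in> W. \<forall>e\<in>B w. X e})} \<le> exp (2 * q ^ b * real (card W) - t)"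
proof -
  have "q ^ b * real (card W) * (exp 1 - 1) \<le> q ^ b * real (card W) * 2"
    using exp_le assms(3) by (intro mult_left_mono) auto
  then show ?thesis
    using chernoff[OF assms, of 1 t] by (simp add: order.trans)
qed

text \<open>For union bounds over all nonempty vertex sets in which every vertex contributes a
  factor \<open>x\<close>. With \<open>y = card V * x <= 1\<close>, the sum is at most
  \<open>exp y - 1 <= y + y^2 <= 2 * y\<close>.\<close>

lemma sum_nonempty_subsets_power:
  fixes x :: real
  assumes V: "finite V" and x: "0 \<le> x" "real (card V) * x \<le> 1"
  shows "(\<Sum>U\<in>Pow V - {{}}. x ^ card U) \<le> 2 * (real (card V) * x)"
proof -
  define y where "y = real (card V) * x"
  have "(\<Sum>U\<in>Pow V. x ^ card U) = (\<Sum>U\<in>Pow V - {{}}. x ^ card U) + 1"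
    using V by (subst sum.remove[of _ "{}"]) auto
  then have "(\<Sum>U\<in>Pow V - {{}}. x ^ card U) = (1 + x) ^ card V - 1"
    by (simp add: sum_Pow_power[OF V])
  also have "(1 + x) ^ card V \<le> exp x ^ card V"
    using x by (intro power_mono exp_ge_add_one_self) auto
  also have "exp x ^ card V = exp y" by (simp add: y_def flip: exp_of_nat_mult)
  also have "exp y \<le> 1 + y + y\<^sup>2" using x by (intro exp_bound) (auto simp: y_def)
  also have "y\<^sup>2 \<le> y" using x by (simp add: y_def power2_eq_square mult_left_le_one_le)
  finally show ?thesis by (simp add: y_def mult.commute)
qed

subsection \<open>The binomial random graph\<close>

lemma finite_pairs_of: "finite V \<Longrightarrow> finite (pairs_of V)"
  by (rule finite_subset[of _ "Pow V"]) (auto simp: pairs_of_def)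

lemma insert_in_pairs_of_iff: "{u, v} \<in> pairs_of V \<longleftrightarrow> u \<in> V \<and> v \<in> V \<and> u \<noteq> v"
  by (cases "u = v") (auto simp: pairs_of_def)

text \<open>Each candidate common neighbour \<open>w\<close> is a block of two edges, and different
  \<open>w\<close> give disjoint blocks.\<close>

lemma prob_small_codegree:
  assumes V: "finite V" and q: "0 \<le> q" "q \<le> 1" and uv: "u \<in> V" "v \<in> V" "u \<noteq> v"
    and t: "t \<le> q\<^sup>2 * (real (card V) - 2) / 2"
  shows "measure_pmf.prob (Pi_pmf (pairs_of V) False (\<lambda>_. bernoulli_pmf q))
      {X. real (card (nbrs {e \<in> pairs_of V. X e} u \<inter> nbrs {e \<in> pairs_of V. X e} v)) \<le> t}
    \<le> exp (- (q\<^sup>2 * (real (card V) - 2) / 8))"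
proof -
  define W where "W = V - {u, v}"
  define B where "B w = {{w, u}, {w, v}}" for w
  have "card {u, v} \<le> card V" using V uv by (intro card_mono) auto
  then have W: "finite W" "real (card W) = real (card V) - 2"
    using V uv by (auto simp: W_def card_Diff_subset)
  have "nbrs {e \<in> pairs_of V. X e} u \<inter> nbrs {e \<in> pairs_of V. X e} v = {w \<in> W. \<forall>e\<in>B w. X e}" for X
    using uv by (auto simp: nbrs_def insert_in_pairs_of_iff W_def B_def)
  moreover have "measure_pmf.prob (Pi_pmf (pairs_of V) False (\<lambda>_. bernoulli_pmf q))
      {X. real (card {w \<in> W. \<forall>e\<in>B w. X e}) \<le> t} \<le> exp (- (q\<^sup>2 * real (card W) / 8))"
  proof (rule chernoff_lower[OF finite_pairs_of[OF V] W(1) q])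
    show "B w \<subseteq> pairs_of V" if "w \<in> W" for w
      using that uv by (auto simp: B_def W_def insert_in_pairs_of_iff)
    show "card (B w) = 2" if "w \<in> W" for w
      using that uv by (auto simp: B_def W_def card_insert_if doubleton_eq_iff)
    show "disjoint_family_on B W"
      by (auto simp: disjoint_family_on_def B_def W_def doubleton_eq_iff)
    show "t \<le> q\<^sup>2 * real (card W) / 2" using t W(2) by simp
  qed
  ultimately show ?thesis by (simp add: W(2))
qed

lemma prob_few_edges_between:
  assumes V: "finite V" and q: "0 \<le> q" "q \<le> 1" and UW: "U \<subseteq> V" "W \<subseteq> V" "U \<inter> W = {}"
  shows "measure_pmf.prob (Pi_pmf (pairs_of V) False (\<lambda>_. bernoulli_pmf q))
      {X. real (edge_count {e \<in> pairs_of V. X e} U W) \<le> q * real (card U) * real (card W) / 2}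
    \<le> exp (- (q * real (card U) * real (card W) / 8))"
proof -
  define B where "B = (\<lambda>(u, w). {{w, u}} :: 'a set set)"
  have fin: "finite U" "finite W" using UW V by (auto intro: finite_subset)
  have "edge_count {e \<in> pairs_of V. X e} U W = card {z \<in> U \<times> W. \<forall>e\<in>B z. X e}" for X
  proof -
    have "{z \<in> U \<times> W. \<forall>e\<in>B z. X e} = (SIGMA u:U. nbrs {e \<in> pairs_of V. X e} u \<inter> W)"
      using UW by (auto simp: B_def nbrs_def insert_in_pairs_of_iff)
    then show ?thesis using fin by (simp add: edge_count_def card_SigmaI)
  qed
  moreover have "measure_pmf.prob (Pi_pmf (pairs_of V) False (\<lambda>_. bernoulli_pmf q))
      {X. real (card {z \<in> U \<times> W. \<forall>e\<in>B z. X e}) \<le> q * real (card U) * real (card W) / 2}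
      \<le> exp (- (q ^ 1 * real (card (U \<times> W)) / 8))"
  proof (rule chernoff_lower[OF finite_pairs_of[OF V] _ q])
    show "finite (U \<times> W)" using fin by simp
    show "B z \<subseteq> pairs_of V" if "z \<in> U \<times> W" for z
      using that UW by (auto simp: B_def insert_in_pairs_of_iff)
    show "card (B z) = 1" if "z \<in> U \<times> W" for z by (simp add: B_def split: prod.split)
    show "disjoint_family_on B (U \<times> W)"
      using UW by (auto simp: disjoint_family_on_def B_def doubleton_eq_iff)
  qed (simp add: mult.assoc card_cartesian_product)
  ultimately show ?thesis by (simp add: mult.assoc card_cartesian_product)
qed

text \<open>The handshake bound: an ordered pair of adjacent vertices is sent injectively to its
  edge together with the chosen endpoint.\<close>

lemma sum_degree_le:
  assumes "finite F"
  shows "(\<Sum>y\<in>F. card (nbrs {e \<in> pairs_of V. X e} y \<inter> F)) \<le> 2 * card {e \<in> pairs_of F. X e}"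
proof -
  let ?EF = "{e \<in> pairs_of F. X e}" and ?N = "\<lambda>y. nbrs {e \<in> pairs_of V. X e} y \<inter> F"
  have finE: "finite ?EF" using finite_pairs_of[OF assms] by simp
  have fine: "finite e" "card e = 2" if "e \<in> ?EF" for e
    using that assms by (auto simp: pairs_of_def intro: finite_subset)
  have "(\<Sum>y\<in>F. card (?N y)) = card (SIGMA y:F. ?N y)"
    using assms by (simp add: card_SigmaI)
  also have "\<dots> \<le> card (SIGMA e:?EF. e)"
  proof (rule card_inj_on_le[where f = "\<lambda>(y, z). ({z, y}, y)"])
    show "inj_on (\<lambda>(y, z). ({z, y}, y)) (SIGMA y:F. ?N y)"
      by (auto simp: inj_on_def doubleton_eq_iff)
    show "(\<lambda>(y, z). ({z, y}, y)) ` (SIGMA y:F. ?N y) \<subseteq> (SIGMA e:?EF. e)"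
      by (auto simp: nbrs_def insert_in_pairs_of_iff)
    show "finite (SIGMA e:?EF. e)" using finE fine by (intro finite_SigmaI) auto
  qed
  also have "\<dots> = (\<Sum>e\<in>?EF. card e)" using finE fine by (intro card_SigmaI) auto
  also have "\<dots> = 2 * card ?EF" using fine by simp
  finally show ?thesis .
qed

text \<open>Minimum degree above \<open>d\<close> forces at least \<open>d * card F / 2\<close>
  edges inside \<open>F\<close>. The upper tail bound applies with mean q times at most
  \<open>(card F)^2 / 2\<close>.\<close>

lemma prob_large_min_degree:
  assumes V: "finite V" and q: "0 \<le> q" "q \<le> 1" and F: "F \<subseteq> V"
  shows "measure_pmf.prob (Pi_pmf (pairs_of V) False (\<lambda>_. bernoulli_pmf q))
      {X. \<forall>y\<in>F. d < card (nbrs {e \<in> pairs_of V. X e} y \<inter> F)}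
    \<le> exp (q * (real (card F))\<^sup>2 - real d * real (card F) / 2)"
proof -
  let ?M = "Pi_pmf (pairs_of V) False (\<lambda>_. bernoulli_pmf q)"
  define t where "t = real d * real (card F) / 2"
  have finF: "finite F" using F V finite_subset by blast
  have "real (card (pairs_of F)) = real (card F choose 2)"
    unfolding pairs_of_def using n_subsets[OF finF, of 2] by simp
  also have "\<dots> = real (card F) * (real (card F) - 1) / 2"
    by (cases "card F") (simp_all add: choose_two real_of_nat_div field_simps)
  finally have pairs: "2 * real (card (pairs_of F)) \<le> (real (card F))\<^sup>2"
    by (simp add: power2_eq_square algebra_simps)
  have "measure_pmf.prob ?M {X. \<forall>y\<in>F. d < card (nbrs {e \<in> pairs_of V. X e} y \<inter> F)}
      \<le> measure_pmf.prob ?M {X. t \<le> real (card {e \<in> pairs_of F. \<forall>e'\<in>{e}. X e'})}"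
  proof (rule measure_pmf.finite_measure_mono)
    show "{X. \<forall>y\<in>F. d < card (nbrs {e \<in> pairs_of V. X e} y \<inter> F)}
        \<subseteq> {X. t \<le> real (card {e \<in> pairs_of F. \<forall>e'\<in>{e}. X e'})}"
    proof
      fix X assume "X \<in> {X. \<forall>y\<in>F. d < card (nbrs {e \<in> pairs_of V. X e} y \<inter> F)}"
      then have "(\<Sum>y\<in>F. d) \<le> (\<Sum>y\<in>F. card (nbrs {e \<in> pairs_of V. X e} y \<inter> F))"
        by (intro sum_mono) (simp add: less_imp_le)
      also have "\<dots> \<le> 2 * card {e \<in> pairs_of F. X e}" by (rule sum_degree_le[OF finF])
      finally have "real (d * card F) \<le> real (2 * card {e \<in> pairs_of F. X e})"
        by (subst of_nat_le_iff) (simp add: mult.commute)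
      then show "X \<in> {X. t \<le> real (card {e \<in> pairs_of F. \<forall>e'\<in>{e}. X e'})}" by (simp add: t_def)
    qed
  qed simp
  also have "\<dots> \<le> exp (2 * q ^ 1 * real (card (pairs_of F)) - t)"
  proof (rule chernoff_upper[OF finite_pairs_of[OF V] finite_pairs_of[OF finF] q])
    show "{e} \<subseteq> pairs_of V" if "e \<in> pairs_of F" for e using that F by (auto simp: pairs_of_def)
  qed (auto simp: disjoint_family_on_def)
  also have "\<dots> \<le> exp (q * (real (card F))\<^sup>2 - t)"
    using mult_left_mono[OF pairs q(1)] by (simp add: mult_ac)
  finally show ?thesis by (simp add: t_def)
qed

text \<open>A union bound over the failures of codegree, density and sparsity, costing 1/n, 4/n and
  2/n respectively. Outside them the graph is pseudorandom.\<close>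

lemma prob_arrows_Pi2_ge:
  fixes n :: nat and q :: real
  assumes n: "3 \<le> n" and q: "0 < q" "q \<le> 1" and qn: "10000 * ln (real n) \<le> q\<^sup>2 * real n"
  shows "1 - 7 / real n \<le> measure_pmf.prob (gnp n q) {G. arrows_Pi2 G}"
proof -
  define L where "L = ln (real n)"
  have L: "1 \<le> L" "real n = exp L" using n exp_le by (auto simp: L_def ln_ge_iff)
  \<comment> \<open>\<open>2 * L\<close> gives \<open>2 ^ k >= n\<close>. Having
    \<open>q * s >= 64 * L\<close> makes the density failure cost \<open>4 * L\<close> per vertex.
    Finally \<open>268 = 2 * (130 + 4)\<close>: here \<open>q * f <= 130 * L\<close> for sets of
    size \<open>f <= 2 * s\<close>, and a margin of \<open>4 * L\<close> per vertex remains.\<close>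
  define k s d where "k = nat \<lceil>2 * L\<rceil>" and "s = nat \<lceil>64 * L / q\<rceil>" and "d = nat \<lceil>268 * L\<rceil>"
  have k: "2 * L \<le> real k" "real k \<le> 3 * L" unfolding k_def using L(1) by linarith+
  have d: "268 * L \<le> real d" "real d \<le> 269 * L" unfolding d_def using L(1) by linarith+
  have "0 \<le> 64 * L / q" using q L(1) by simp
  then have "64 * L / q \<le> real s" "real s \<le> 64 * L / q + 1" unfolding s_def by linarith+
  then have "64 * L \<le> q * real s" "q * real s \<le> 64 * L + q" using q by (simp_all add: field_simps)
  then have s: "64 * L \<le> q * real s" "q * real s \<le> 65 * L" using q(2) L(1) by linarith+
  have "q\<^sup>2 * real n \<le> 1 * real n" using q by (intro mult_right_mono) (auto simp: power_le_one)
  then have n4: "4 \<le> real n" using qn L(1) unfolding L_def by linarith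
  have "q\<^sup>2 * 4 \<le> q\<^sup>2 * real n" using n4 by (intro mult_left_mono) auto
  then have qn2: "5000 * L \<le> q\<^sup>2 * (real n - 2)" using qn by (simp add: L_def algebra_simps)
  define V where "V = {1..n}"
  have V: "finite V" "card V = n" by (auto simp: V_def)
  define M where "M = Pi_pmf (pairs_of V) False (\<lambda>_. bernoulli_pmf q)"
  define E where "E X = {e \<in> pairs_of V. X e}" for X
  \<comment> \<open>This is \<open>n ^ - 4\<close>, the price per vertex in the union bounds over
    vertex sets.\<close>
  define x where "x = exp (- (4 * L))"
  have nx: "real n * x \<le> 1 / real n"
    using L(1) by (simp add: x_def L(2) flip: exp_add exp_minus inverse_eq_divide)
  have n1: "1 / real n \<le> 1" using n by simp
  have x0: "0 \<le> x" by (simp add: x_def)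
  have sumx: "(\<Sum>U\<in>Pow V - {{}}. x ^ card U) \<le> 2 / real n"
    using sum_nonempty_subsets_power[OF V(1) x0] nx n1 V(2) by simp
  have xpow: "x ^ m = exp (- (4 * L * real m))" for m
    by (simp add: x_def mult_ac flip: exp_of_nat_mult)

  define I1 where "I1 = {z \<in> V \<times> V. fst z \<noteq> snd z}"
  define bad1 where "bad1 = (\<lambda>(u, v). {X. real (card (nbrs (E X) u \<inter> nbrs (E X) v)) \<le> real (d + 3 * k)})"
  define I2 where "I2 = {z \<in> (Pow V - {{}}) \<times> (Pow V - {{}}). fst z \<inter> snd z = {} \<and>
    s \<le> card (fst z) \<and> s \<le> card (snd z)}"
  define bad2 where "bad2 = (\<lambda>(U, W). {X. real (edge_count (E X) U W) \<le> q * real (card U) * real (card W) / 2})"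
  define I3 where "I3 = {F \<in> Pow V - {{}}. card F \<le> 2 * s}"
  define bad3 where "bad3 F = {X. \<forall>y\<in>F. d < card (nbrs (E X) y \<inter> F)}" for F
  have finI: "finite I1" "finite I2" "finite I3" using V(1) by (auto simp: I1_def I2_def I3_def)

  have "measure_pmf.prob M (\<Union>z\<in>I1. bad1 z) \<le> (\<Sum>z\<in>I1. measure_pmf.prob M (bad1 z))"
    by (rule measure_UNION_le[OF finI(1)]) simp
  \<comment> \<open>Only \<open>n ^ - 3\<close> per pair is kept of a far smaller bound, enough
    against at most \<open>n^2\<close> ordered pairs.\<close>
  also have "\<dots> \<le> (\<Sum>z\<in>I1. exp (- (3 * L)))"
  proof (rule sum_mono)
    fix z assume "z \<in> I1"
    then obtain u v where z: "z = (u, v)" "u \<in> V" "v \<in> V" "u \<noteq> v" by (auto simp: I1_def)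
    have "measure_pmf.prob M (bad1 z) \<le> exp (- (q\<^sup>2 * (real (card V) - 2) / 8))"
      unfolding M_def bad1_def z(1) prod.case E_def
    proof (rule prob_small_codegree[OF V(1) _ q(2) z(2-4)])
      show "real (d + 3 * k) \<le> q\<^sup>2 * (real (card V) - 2) / 2"
        using d(2) k(2) qn2 L(1) V(2) by simp
    qed (use q in simp)
    also have "\<dots> \<le> exp (- (3 * L))" using qn2 L(1) V(2) by simp
    finally show "measure_pmf.prob M (bad1 z) \<le> exp (- (3 * L))" .
  qed
  also have "\<dots> \<le> (real n * real n) * exp (- (3 * L))"
  proof -
    have "card I1 \<le> card (V \<times> V)" using V(1) by (intro card_mono) (auto simp: I1_def)
    then have "real (card I1) \<le> real (n * n)" using V(2) by (subst of_nat_le_iff) (simp add: card_cartesian_product)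
    then show ?thesis by simp
  qed
  also have "\<dots> = 1 / real n"
    by (simp add: L(2) flip: exp_add exp_minus inverse_eq_divide)
  finally have p1: "measure_pmf.prob M (\<Union>z\<in>I1. bad1 z) \<le> 1 / real n" .

  have "measure_pmf.prob M (\<Union>z\<in>I2. bad2 z) \<le> (\<Sum>z\<in>I2. measure_pmf.prob M (bad2 z))"
    by (rule measure_UNION_le[OF finI(2)]) simp
  also have "\<dots> \<le> (\<Sum>z\<in>I2. x ^ card (fst z) * x ^ card (snd z))"
  proof (rule sum_mono)
    fix z assume "z \<in> I2"
    then obtain U W where z: "z = (U, W)" "U \<subseteq> V" "W \<subseteq> V" "U \<inter> W = {}" "s \<le> card U" "s \<le> card W"
      by (auto simp: I2_def)
    define a b where "a = real (card U)" and "b = real (card W)"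
    have ab: "real s \<le> a" "real s \<le> b" using z by (auto simp: a_def b_def)
    have "real s * b \<le> a * b" "real s * a \<le> b * a"
      using ab by (auto intro: mult_right_mono)
    then have "real s * (a + b) \<le> 2 * (a * b)" by (simp add: distrib_left mult.commute)
    then have "q * (real s * (a + b)) \<le> q * (2 * (a * b))" using q by simp
    moreover have "64 * L * (a + b) \<le> q * real s * (a + b)"
      using s(1) ab by (intro mult_right_mono) auto
    ultimately have *: "4 * L * a + 4 * L * b \<le> q * a * b / 8" by (simp add: algebra_simps)
    have "measure_pmf.prob M (bad2 z) \<le> exp (- (q * a * b / 8))"
      unfolding M_def bad2_def z(1) prod.case E_def a_def b_def
      by (rule prob_few_edges_between[OF V(1) _ q(2) z(2-4)]) (use q in simp)
    also have "\<dots> \<le> exp (- (4 * L * a + 4 * L * b))" using * by simp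
    also have "\<dots> = x ^ card U * x ^ card W"
      by (simp add: xpow a_def b_def flip: exp_add)
    finally show "measure_pmf.prob M (bad2 z) \<le> x ^ card (fst z) * x ^ card (snd z)" by (simp add: z(1))
  qed
  \<comment> \<open>Dropping disjointness and the size conditions lets the sum factor into two
    identical sums over nonempty sets.\<close>
  also have "\<dots> \<le> (\<Sum>z\<in>(Pow V - {{}}) \<times> (Pow V - {{}}). x ^ card (fst z) * x ^ card (snd z))"
    using V(1) x0 by (intro sum_mono2) (auto simp: I2_def)
  also have "\<dots> = (\<Sum>U\<in>Pow V - {{}}. x ^ card U) * (\<Sum>U\<in>Pow V - {{}}. x ^ card U)"
    by (simp add: sum_product sum.cartesian_product case_prod_beta)
  also have "\<dots> \<le> (2 / real n) * (2 / real n)"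
    using sumx x0 by (intro mult_mono sum_nonneg) auto
  also have "\<dots> \<le> 4 / real n"
    using n by (simp add: field_simps)
  finally have p2: "measure_pmf.prob M (\<Union>z\<in>I2. bad2 z) \<le> 4 / real n" .

  have "measure_pmf.prob M (\<Union>F\<in>I3. bad3 F) \<le> (\<Sum>F\<in>I3. measure_pmf.prob M (bad3 F))"
    by (rule measure_UNION_le[OF finI(3)]) simp
  also have "\<dots> \<le> (\<Sum>F\<in>I3. x ^ card F)"
  proof (rule sum_mono)
    fix F assume F: "F \<in> I3"
    define f where "f = real (card F)"
    have f: "0 \<le> f" "f \<le> 2 * real s" using F by (auto simp: f_def I3_def)
    have "measure_pmf.prob M (bad3 F) \<le> exp (q * f\<^sup>2 - real d * f / 2)"
      unfolding M_def bad3_def E_def f_def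
      by (rule prob_large_min_degree[OF V(1) _ q(2)]) (use q F in \<open>auto simp: I3_def\<close>)
    also have "\<dots> \<le> exp (- (4 * L * f))"
    proof -
      have "q * f \<le> q * (2 * real s)" using f(2) q(1) by (intro mult_left_mono) auto
      then have "q * f - real d / 2 \<le> - (4 * L)" using s(2) d(1) by simp
      then have "(q * f - real d / 2) * f \<le> - (4 * L) * f" using f(1) by (rule mult_right_mono)
      then show ?thesis by (simp add: algebra_simps power2_eq_square)
    qed
    finally show "measure_pmf.prob M (bad3 F) \<le> x ^ card F" by (simp add: xpow f_def)
  qed
  also have "\<dots> \<le> (\<Sum>F\<in>Pow V - {{}}. x ^ card F)"
    using V(1) x0 by (intro sum_mono2) (auto simp: I3_def)
  finally have p3: "measure_pmf.prob M (\<Union>F\<in>I3. bad3 F) \<le> 2 / real n" using sumx by simp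

  define bad where "bad = (\<Union>z\<in>I1. bad1 z) \<union> (\<Union>z\<in>I2. bad2 z) \<union> (\<Union>F\<in>I3. bad3 F)"
  have "measure_pmf.prob M bad \<le> measure_pmf.prob M (\<Union>z\<in>I1. bad1 z) +
      measure_pmf.prob M (\<Union>z\<in>I2. bad2 z) + measure_pmf.prob M (\<Union>F\<in>I3. bad3 F)"
    unfolding bad_def by (intro order.trans[OF measure_Un_le] add_mono) auto
  then have pbad: "measure_pmf.prob M bad \<le> 7 / real n" using p1 p2 p3 by simp

  have good: "arrows_Pi2 \<lparr>verts = V, edges = E X\<rparr>" if "X \<notin> bad" for X
  proof -
    have X1: "X \<notin> bad1 z" if "z \<in> I1" for z using \<open>X \<notin> bad\<close> that by (auto simp: bad_def)
    have X2: "X \<notin> bad2 z" if "z \<in> I2" for z using \<open>X \<notin> bad\<close> that by (auto simp: bad_def)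
    have X3: "X \<notin> bad3 z" if "z \<in> I3" for z using \<open>X \<notin> bad\<close> that by (auto simp: bad_def)
    have k0: "0 < real k" using k(1) L(1) by linarith
    have s0: "0 < s" using s(1) L(1) by (cases "s = 0") auto
    interpret pseudorandom_graph V "E X" q k d s
    proof
      show "finite V" by (rule V(1))
      show "E X \<subseteq> pairs_of V" by (auto simp: E_def)
      show "0 < k" using k0 by simp
      show "card V \<le> 2 ^ k"
      proof -
        \<comment> \<open>Since \<open>ln 2 >= 1 / 2\<close>, \<open>k * ln 2 >= L\<close>, that is,
          \<open>2 ^ k >= n\<close>.\<close>
        have "2 * L * (1 / 2) \<le> real k * ln 2"
          using k(1) ln2_ge_two_thirds L(1) by (intro mult_mono) auto
        then have "real n \<le> exp (real k * ln 2)" using L(2) by simp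
        also have "\<dots> = 2 ^ k" by (simp add: exp_of_nat_mult)
        finally have "real n \<le> real (2 ^ k)" by simp
        then show ?thesis unfolding V(2) by (simp only: of_nat_le_iff)
      qed
      show "0 < q" "q \<le> 1" by (rule q)+
      show "8 * real k \<le> q * real s" using k(2) s(1) L(1) by linarith
      show "32 * real s \<le> q * real (card V)"
      proof -
        have "32 * (q * real s) \<le> q\<^sup>2 * real n" using s(2) qn L(1) unfolding L_def by linarith
        then have "q * (32 * real s) \<le> q * (q * real n)" by (simp add: power2_eq_square mult_ac)
        then show ?thesis using q(1) V(2) by simp
      qed
      show "d + 3 * k \<le> card (nbrs (E X) u \<inter> nbrs (E X) v)" if "u \<in> V" "v \<in> V" "u \<noteq> v" for u v
        using X1[of "(u, v)"] that by (simp add: I1_def bad1_def)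
      show "q * real (card U) * real (card W) / 2 \<le> real (edge_count (E X) U W)"
        if "U \<subseteq> V" "W \<subseteq> V" "U \<inter> W = {}" "s \<le> card U" "s \<le> card W" for U W
      proof -
        have "U \<noteq> {}" "W \<noteq> {}" using that s0 by auto
        then show ?thesis using X2[of "(U, W)"] that by (simp add: I2_def bad2_def)
      qed
      show "\<exists>y\<in>F. card (nbrs (E X) y \<inter> F) \<le> d" if "F \<subseteq> V" "F \<noteq> {}" "card F \<le> 2 * s" for F
        using X3[of F] that by (auto simp: I3_def bad3_def not_less)
    qed
    show ?thesis by (rule arrows_Pi2)
  qed
  have "1 - 7 / real n \<le> 1 - measure_pmf.prob M bad" using pbad by simp
  also have "\<dots> = measure_pmf.prob M (- bad)"
    using measure_pmf.prob_compl[of bad M] by (simp add: Compl_eq_Diff_UNIV)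
  also have "\<dots> \<le> measure_pmf.prob M {X. arrows_Pi2 \<lparr>verts = V, edges = E X\<rparr>}"
    using good by (intro measure_pmf.finite_measure_mono) auto
  also have "\<dots> = measure_pmf.prob (gnp n q) {G. arrows_Pi2 G}"
    by (simp add: gnp_def M_def E_def V_def vimage_def)
  finally show ?thesis .
qed

section \<open>Passage to the limit\<close>

theorem theorem1p1:
  fixes p :: "nat \<Rightarrow> real"
  assumes "\<And>n. 0 \<le> p n \<and> p n \<le> 1"
    and "filterlim (\<lambda>n. p n / (ln (real n) / real n) powr (1 / 2)) at_top sequentially"
  shows "(\<lambda>n. measure_pmf.prob (gnp n (p n)) {G. arrows_Pi2 G}) \<longlonglongrightarrow> 1"
proof (rule tendsto_sandwich)
  \<comment> \<open>The ratio eventually exceeds 100, and squaring yields the constant 10000 of the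
    quantitative bound.\<close>
  have "\<forall>\<^sub>F n in sequentially. 100 \<le> p n / (ln (real n) / real n) powr (1 / 2)"
    using assms(2) unfolding filterlim_at_top by blast
  then show "\<forall>\<^sub>F n in sequentially. 1 - 7 / real n \<le> measure_pmf.prob (gnp n (p n)) {G. arrows_Pi2 G}"
    using eventually_ge_at_top[of 3]
  proof eventually_elim
    case (elim n)
    have L: "0 < ln (real n) / real n" using elim(2) by simp
    define r where "r = sqrt (ln (real n) / real n)"
    have r: "0 < r" "r\<^sup>2 = ln (real n) / real n" using L by (auto simp: r_def)
    have "(ln (real n) / real n) powr (1 / 2) = r" using L by (simp add: r_def powr_half_sqrt)
    then have pr: "100 * r \<le> p n" using elim(1) r(1) by (simp add: pos_le_divide_eq)
    then have "(100 * r)\<^sup>2 \<le> (p n)\<^sup>2" using r(1) by (intro power_mono) auto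
    then have "10000 * (ln (real n) / real n) \<le> (p n)\<^sup>2" by (simp add: power_mult_distrib r(2))
    then have "10000 * ln (real n) \<le> (p n)\<^sup>2 * real n" using elim(2) by (simp add: field_simps)
    moreover have "0 < p n" using pr r(1) by linarith
    ultimately show ?case using prob_arrows_Pi2_ge[OF elim(2)] assms(1) by blast
  qed
  show "\<forall>\<^sub>F n in sequentially. measure_pmf.prob (gnp n (p n)) {G. arrows_Pi2 G} \<le> 1"
    by simp
  show "(\<lambda>n. 1 - 7 / real n) \<longlonglongrightarrow> 1"
    using tendsto_diff[OF tendsto_const lim_const_over_n[of 7], of 1] by simp
qed simp

end
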